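(* Let $0<a<1$, $\hat c\in\{-1,-2,\dots\}$, and let $\mathcal F=(F_1,F_2)$ be a pair of finite sets of positive integers satisfying (C): $\{0,1,\dots,-\hat c\}\subset F_1\cup(-\hat c-F_2)$, and assume $\hat c$ and $\mathcal F$ are admissible, i.e. $\prod_{h\in\mathcal H}(x-h)\ge0$ for all $x\in\mathbb N\setminus F_1$. Then the polynomials $m_n^{a,\hat c;\mathcal F}$, $n\in\sigma_{\mathcal F}$, are orthogonal with respect to the positive measure $$\omega^{\mathcal F}_{a,\hat c}=\sum_{x=0}^\infty\frac{a^x\Gamma(x+\hat c+k)}{x!\,\Omega^{a,\hat c}_{\mathcal F}(x)\Omega^{a,\hat c}_{\mathcal F}(x+1)}\delta_x,$$ with $\|m_n^{a,\hat c;\mathcal F}\|_2^2=\frac{a^{n-u_{\mathcal F}+k_1-2k}}{(1-a)^{\hat c+2n-2u_{\mathcal F}-k}}\prod_{h\in\mathcal H}(n-u_{\mathcal F}-h)$. Moreover, the linear combinations of the $m_n^{a,\hat c;\mathcal F}$, $n\in\sigma_{\mathcal F}$, are dense in $L^2(\omega^{\mathcal F}_{a,\hat c})$.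
   Context: $\mathbb N=\{0,1,\dots\}$; $t-F=\{t-f:f\in F\}$; $k_i=|F_i|$, $k=k_1+k_2$. $\mathcal H=[(F_1\cup(-\hat c-F_2))\setminus\{0,\dots,-\hat c\}]\cup[F_1\cap(-\hat c-F_2)]$. Meixner polynomials $m_n^{a,c}(x)=\frac{a^n}{(1-a)^n}\sum_{j=0}^n a^{-j}\binom{x}{j}\binom{-x-c}{n-j}$. $\Omega^{a,c}_{\mathcal F}(x)$ is the $k\times k$ determinant with rows $\big(m_f^{a,c}(x+j-1)\big)_{j=1}^k$, $f\in F_1$ (increasing), followed by rows $\big(m_f^{1/a,c}(x+j-1)/a^{j-1}\big)_{j=1}^k$, $f\in F_2$. $u_{\mathcal F}=\sum_{f\in F_1}f+\sum_{f\in F_2}f-\binom{k_1+1}{2}-\binom{k_2}{2}$; $\sigma_{\mathcal F}=\{u_{\mathcal F},u_{\mathcal F}+1,\dots\}\setminus\{u_{\mathcal F}+f:f\in F_1\}$. For $n\in\sigma_{\mathcal F}$, $m_n^{a,\hat c;\mathcal F}(x)$ is the $(k+1)\times(k+1)$ determinant with first row $\big(m^{a,\hat c}_{n-u_{\mathcal F}}(x+j-1)\big)_{j=1}^{k+1}$, then rows $\big(m_f^{a,\hat c}(x+j-1)\big)_{j=1}^{k+1}$, $f\in F_1$, then rows $\big(m_f^{1/a,\hat c}(x+j-1)/a^{j-1}\big)_{j=1}^{k+1}$, $f\in F_2$. *)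

theory Defs
  imports "HOL-Analysis.Analysis"
begin

definition ldet :: "nat \<Rightarrow> (nat \<Rightarrow> nat \<Rightarrow> real) \<Rightarrow> real" where
  "ldet k M = (\<Sum>p | p permutes {..<k}. of_int (sign p) * (\<Prod>i<k. M i (p i)))"

definition meixner :: "real \<Rightarrow> real \<Rightarrow> nat \<Rightarrow> real \<Rightarrow> real" where
  "meixner a c n x = (a ^ n / (1 - a) ^ n) *
     (\<Sum>j\<le>n. (1 / a) ^ j * (x gchoose j) * ((- x - c) gchoose (n - j)))"

definition omega_entry :: "real \<Rightarrow> real \<Rightarrow> nat set \<Rightarrow> nat set \<Rightarrow> real \<Rightarrow> nat \<Rightarrow> nat \<Rightarrow> real" where
  "omega_entry a c F1 F2 x i j =
     (if i < card F1 then meixner a c (sorted_list_of_set F1 ! i) (x + real j)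
      else meixner (1 / a) c (sorted_list_of_set F2 ! (i - card F1)) (x + real j) / a ^ j)"

definition Omega :: "real \<Rightarrow> real \<Rightarrow> nat set \<Rightarrow> nat set \<Rightarrow> real \<Rightarrow> real" where
  "Omega a c F1 F2 x = ldet (card F1 + card F2) (omega_entry a c F1 F2 x)"

definition uF :: "nat set \<Rightarrow> nat set \<Rightarrow> int" where
  "uF F1 F2 = int (\<Sum>F1) + int (\<Sum>F2) - int ((card F1 + 1) choose 2) - int (card F2 choose 2)"

definition sigmaF :: "nat set \<Rightarrow> nat set \<Rightarrow> nat set" where
  "sigmaF F1 F2 = {n. uF F1 F2 \<le> int n} - {n. \<exists>f\<in>F1. int n = uF F1 F2 + int f}"

definition exc_meixner :: "real \<Rightarrow> real \<Rightarrow> nat set \<Rightarrow> nat set \<Rightarrow> nat \<Rightarrow> real \<Rightarrow> real" where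
  "exc_meixner a c F1 F2 n x = ldet (card F1 + card F2 + 1)
     (\<lambda>i j. if i = 0 then meixner a c (nat (int n - uF F1 F2)) (x + real j)
            else omega_entry a c F1 F2 x (i - 1) j)"

definition HF :: "int \<Rightarrow> nat set \<Rightarrow> nat set \<Rightarrow> int set" where
  "HF ch F1 F2 = ((int ` F1 \<union> (\<lambda>f. - ch - int f) ` F2) - {0 .. - ch})
                  \<union> (int ` F1 \<inter> (\<lambda>f. - ch - int f) ` F2)"

definition admissible :: "int \<Rightarrow> nat set \<Rightarrow> nat set \<Rightarrow> bool" where
  "admissible ch F1 F2 \<longleftrightarrow> (\<forall>x::nat. x \<notin> F1 \<longrightarrow> (\<Prod>h\<in>HF ch F1 F2. int x - h) \<ge> 0)"

definition weightF :: "real \<Rightarrow> int \<Rightarrow> nat set \<Rightarrow> nat set \<Rightarrow> nat \<Rightarrow> real" where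
  "weightF a ch F1 F2 x = a ^ x * Gamma (real x + of_int ch + real (card F1 + card F2)) /
     (fact x * Omega a (of_int ch) F1 F2 (real x) * Omega a (of_int ch) F1 F2 (real x + 1))"

end

theory Submission
  imports Defs "Jordan_Normal_Form.Determinant"
begin

text \<open>
  Put $N = -\hat c$ and $R_x(t) = (1+t/a)^x (1+t)^{N-x}$. Up to factors depending only on the row,
  the $F_1$-rows of the determinants are Taylor coefficients $A_f(x)$ of $R_x$ at $0$ and the $F_2$-rows are
  coefficients $B_{N-f}(x)$ of its expansion at infinity. Since the only other pole of $R_x$ is $-1$,
  the jump $A_v(x) - B_v(x)$ is $(-1)^v$ times a polynomial in $v$, of degree $x-N-1$ if $x > N$ and zero
  otherwise. Together with (C) this makes the exceptional polynomial $m_{u+v}(x)$, for $v \notin F_1$, equal to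
  $\gamma_v q_x(v)$ with a polynomial $q_x$ of degree $x$ in $v$. As $R_x$ vanishes to order $x$ at $-a$,
  $\sum_v (-a)^v s(v) A_v(x) = 0$ for $\deg s < x$, so the $q_x$ are orthogonal for
  $\mu = \sum_{v \notin F_1} a^v \prod_{h\in\mathcal H}(v-h)\,\delta_v$, and their norms are multiples
  of $\Omega(x)\Omega(x+1)$, which is therefore positive. Polynomials are dense in $L^2(\mu)$, so the matrix
  $q_x(v)\sqrt{\mu(v)}/\|q_x\|$ is unitary; reading it by columns gives the theorem.
\<close>

subsection \<open>Determinants\<close>

text \<open>The degree x of q_x is the outcome of a count. At each h in \<open>H\<close> the
  coefficient combination at 0 is killed by a determinant row or by the range of the expansion, and
  so is the one at infinity; hence the jump of the cofactor combination vanishes on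
  \<open>H\<close>. By (C), |H| = k - N - 1, while a combination of R_x, ..., R_{x+k} has a jump of
  degree at most x + k - N - 1, so degree at most x remains after division by the factors of
  \<open>H\<close>. The obstacle is that the weight has Omega(x) Omega(x+1) in its denominator, and
  nothing says beforehand that this is nonzero. The dual side has no such denominator: the leading
  coefficient of q_x is a nonzero multiple of Omega(x), and once it is nonzero, the squared norm of
  q_x, a positive multiple of Omega(x) Omega(x+1), is positive. So nonvanishing passes from x to
  x+1, and only x = 0 needs an argument of its own. Completeness of the rows q_x yields
  orthogonality of the columns; completeness of the columns is in turn the norm identity of each
  row.\<close>

lemma ldet_eq_det: "ldet k M = Determinant.det (Matrix.mat k k (\<lambda>(i, j). M i j))"
  unfolding ldet_def Determinant.det_def
  by (auto simp: atLeast0LessThan[symmetric] permutes_in_image intro!: sum.cong prod.cong)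

lemma ldet_cong:
  assumes "\<And>i j. i < k \<Longrightarrow> j < k \<Longrightarrow> M i j = M' i j"
  shows "ldet k M = ldet k M'"
  unfolding ldet_def
proof (rule sum.cong[OF refl])
  fix p assume "p \<in> {p. p permutes {..<k}}"
  then have "p i < k" if "i < k" for i using permutes_in_image[of p "{..<k}" i] that by simp
  then show "of_int (sign p) * (\<Prod>i<k. M i (p i)) = of_int (sign p) * (\<Prod>i<k. M' i (p i))"
    by (simp add: assms)
qed

lemma ldet_scale_rows: "ldet k (\<lambda>i j. s i * M i j) = (\<Prod>i<k. s i) * ldet k M"
  unfolding ldet_def by (simp add: prod.distrib sum_distrib_left mult_ac)

lemma ldet_eq_0_imp_kernel:
  assumes "ldet k M = 0"
  obtains c where "\<exists>j<k. c j \<noteq> 0" "\<And>i. i < k \<Longrightarrow> (\<Sum>j<k. c j * M i j) = 0"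
proof -
  let ?A = "Matrix.mat k k (\<lambda>(i, j). M i j)"
  have A: "?A \<in> carrier_mat k k" by simp
  from assms obtain v where v: "v \<in> carrier_vec k" "v \<noteq> 0\<^sub>v k" "?A *\<^sub>v v = 0\<^sub>v k"
    unfolding ldet_eq_det det_0_iff_vec_prod_zero[OF A] by auto
  show ?thesis
  proof (rule that[of "\<lambda>j. vec_index v j"])
    show "\<exists>j<k. vec_index v j \<noteq> 0"
      using v(1,2) by (metis carrier_vecD eq_vecI index_zero_vec(1) index_zero_vec(2))
    show "(\<Sum>j<k. vec_index v j * M i j) = 0" if "i < k" for i
    proof -
      have "vec_index (?A *\<^sub>v v) i = 0" using v(3) that by simp
      then show ?thesis using that v(1)
        by (simp add: scalar_prod_def atLeast0LessThan mult.commute)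
    qed
  qed
qed

text \<open>Only the k lower rows enter, so the exceptional polynomials for all n are linear forms
  in their first rows with the same coefficients.\<close>

definition first_row_cofactor :: "nat \<Rightarrow> (nat \<Rightarrow> nat \<Rightarrow> real) \<Rightarrow> nat \<Rightarrow> real" where
  "first_row_cofactor k M j = (- 1) ^ j * ldet k (\<lambda>i j'. M i (if j' < j then j' else Suc j'))"

lemma ldet_first_row_expansion:
  "ldet (Suc k) (\<lambda>i j. if i = 0 then r j else M (i - 1) j) = (\<Sum>j\<le>k. first_row_cofactor k M j * r j)"
proof -
  let ?A = "Matrix.mat (Suc k) (Suc k) (\<lambda>(i, j). if i = 0 then r j else M (i - 1) j)"
  have del: "mat_delete ?A 0 j = Matrix.mat k k (\<lambda>(i, j'). M i (if j' < j then j' else Suc j'))" for j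
    by (rule eq_matI) (auto simp: mat_delete_def)
  have "Determinant.det ?A = (\<Sum>j<Suc k. ?A $$ (0, j) * cofactor ?A 0 j)"
    by (rule laplace_expansion_row) auto
  also have "\<dots> = (\<Sum>j<Suc k. first_row_cofactor k M j * r j)"
    by (rule sum.cong) (simp_all add: cofactor_def del first_row_cofactor_def ldet_eq_det)
  finally show ?thesis by (simp add: ldet_eq_det lessThan_Suc_atMost)
qed

text \<open>Putting a lower row in place of the first one produces two equal rows.\<close>

lemma first_row_cofactor_orthogonal:
  assumes "i < k"
  shows "(\<Sum>j\<le>k. first_row_cofactor k M j * M i j) = 0"
proof -
  have "ldet (Suc k) (\<lambda>i' j. if i' = 0 then M i j else M (i' - 1) j) = 0"
    unfolding ldet_eq_det
    by (rule det_identical_rows[of _ "Suc k" 0 "Suc i"]) (use assms in \<open>auto intro!: eq_vecI\<close>)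
  then show ?thesis by (simp only: ldet_first_row_expansion)
qed

text \<open>The two extreme cofactors are the source of Omega(x+1) and Omega(x) in the norms:
  deleting column 0 shifts the argument, deleting column k does not.\<close>

lemma first_row_cofactor_0: "first_row_cofactor k M 0 = ldet k (\<lambda>i j. M i (Suc j))"
  by (simp add: first_row_cofactor_def)

lemma first_row_cofactor_last: "first_row_cofactor k M k = (- 1) ^ k * ldet k M"
  unfolding first_row_cofactor_def by (subst ldet_cong[where M' = M]) auto

subsection \<open>Density of polynomials for geometrically decaying weights\<close>

definition gbinomial_poly :: "real \<Rightarrow> nat \<Rightarrow> real poly" where
  "gbinomial_poly c m = Polynomial.smult (1 / fact m) (\<Prod>i<m. [:c - real i, 1:])"

lemma poly_gbinomial_poly: "poly (gbinomial_poly c m) t = (t + c) gchoose m"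
  by (simp add: gbinomial_poly_def gbinomial_prod_rev poly_prod atLeast0LessThan algebra_simps)

lemma degree_gbinomial_poly: "degree (gbinomial_poly c m) = m"
  and coeff_gbinomial_poly: "coeff (gbinomial_poly c m) m = 1 / fact m"
proof -
  have "degree (\<Prod>i<m. [:c - real i, 1:]) = m"
    by (simp add: degree_prod_eq_sum_degree)
  moreover have "lead_coeff (\<Prod>i<m. [:c - real i, 1:]) = 1"
    by (simp add: lead_coeff_prod del: degree_prod_eq_sum_degree)
  ultimately show "degree (gbinomial_poly c m) = m" "coeff (gbinomial_poly c m) m = 1 / fact m"
    by (auto simp: gbinomial_poly_def)
qed

lemma poly_times_geometric_bounded:
  fixes p :: "real poly"
  assumes "0 \<le> r" "r < 1"
  shows "\<exists>C>0. \<forall>v::nat. \<bar>poly p (real v)\<bar> * r ^ v \<le> C"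
  using assms
proof (induction p arbitrary: r)
  case 0
  then show ?case by (intro exI[of _ 1]) auto
next
  case (pCons a p)
  \<comment> \<open>Half of the decay pays for the extra factor v, the other half for the remaining
    polynomial.\<close>
  define s where "s = sqrt r"
  have s: "0 \<le> s" "s < 1" "s * s = r" using pCons.prems by (auto simp: s_def real_sqrt_lt_1_iff)
  obtain C where C: "C > 0" "\<And>v::nat. \<bar>poly p (real v)\<bar> * s ^ v \<le> C"
    using pCons.IH[OF s(1,2)] by auto
  have "(\<lambda>n. real n * s ^ n) \<longlonglongrightarrow> 0"
    using powser_times_n_limit_0[of s] s by simp
  then have "Bseq (\<lambda>n. real n * s ^ n)"
    by (intro convergent_imp_Bseq) (auto simp: convergent_def)
  then obtain K where K: "K > 0" "\<And>n. norm (real n * s ^ n) \<le> K"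
    by (rule BseqE) blast
  show ?case
  proof (intro exI[of _ "\<bar>a\<bar> + K * C + 1"] conjI allI)
    show "\<bar>a\<bar> + K * C + 1 > 0" using K(1) C(1) by (simp add: add_nonneg_pos)
    fix v :: nat
    have rv: "r ^ v = s ^ v * s ^ v" using s(3) by (simp add: power_mult_distrib[symmetric])
    have "r ^ v \<le> 1" using pCons.prems by (simp add: power_le_one)
    have "\<bar>poly (pCons a p) (real v)\<bar> * r ^ v
        \<le> (\<bar>a\<bar> + real v * \<bar>poly p (real v)\<bar>) * r ^ v"
      using pCons.prems by (intro mult_right_mono) (auto simp: abs_mult intro: order_trans[OF abs_triangle_ineq])
    also have "\<dots> = \<bar>a\<bar> * r ^ v + (real v * s ^ v) * (\<bar>poly p (real v)\<bar> * s ^ v)"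
      by (simp add: rv algebra_simps)
    also have "\<dots> \<le> \<bar>a\<bar> * 1 + K * C"
      using K(2)[of v] C(2)[of v] K(1) s \<open>r ^ v \<le> 1\<close>
      by (intro add_mono mult_mono) (auto simp: abs_mult)
    finally show "\<bar>poly (pCons a p) (real v)\<bar> * r ^ v \<le> \<bar>a\<bar> + K * C + 1" by simp
  qed
qed

text \<open>Approximation in a weighted sup norm rather than in l2: here a polynomial factor can be
  absorbed by a slight change of \<open>b\<close>, and l2 bounds follow by summing a geometric
  series.\<close>

definition poly_approximable :: "real \<Rightarrow> (nat \<Rightarrow> real) \<Rightarrow> bool" where
  "poly_approximable b f \<longleftrightarrow> (\<forall>\<epsilon>>0. \<exists>p. \<forall>v. b ^ v * \<bar>f v - poly p (real v)\<bar> \<le> \<epsilon>)"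

lemma poly_approximable_add:
  assumes "poly_approximable b f" "poly_approximable b g" "0 \<le> b"
  shows "poly_approximable b (\<lambda>v. f v + g v)"
  unfolding poly_approximable_def
proof (intro allI impI)
  fix \<epsilon> :: real assume "\<epsilon> > 0"
  then have "\<epsilon> / 2 > 0" by simp
  with assms(1,2) obtain p q where pq: "\<And>v. b ^ v * \<bar>f v - poly p (real v)\<bar> \<le> \<epsilon> / 2"
    "\<And>v. b ^ v * \<bar>g v - poly q (real v)\<bar> \<le> \<epsilon> / 2"
    unfolding poly_approximable_def by metis
  show "\<exists>p. \<forall>v. b ^ v * \<bar>f v + g v - poly p (real v)\<bar> \<le> \<epsilon>"
  proof (intro exI[of _ "p + q"] allI)
    fix v
    have "b ^ v * \<bar>f v + g v - poly (p + q) (real v)\<bar>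
        \<le> b ^ v * (\<bar>f v - poly p (real v)\<bar> + \<bar>g v - poly q (real v)\<bar>)"
      using assms(3) by (intro mult_left_mono) auto
    also have "\<dots> \<le> \<epsilon>" using pq[of v] by (simp add: distrib_left)
    finally show "b ^ v * \<bar>f v + g v - poly (p + q) (real v)\<bar> \<le> \<epsilon>" .
  qed
qed

lemma poly_approximable_0: "poly_approximable b (\<lambda>v. 0)"
  unfolding poly_approximable_def by (intro allI impI exI[of _ 0]) auto

lemma poly_approximable_sum:
  assumes "finite A" "0 \<le> b" "\<And>m. m \<in> A \<Longrightarrow> poly_approximable b (f m)"
  shows "poly_approximable b (\<lambda>v. \<Sum>m\<in>A. f m v)"
  using assms by (induction A rule: finite_induct) (auto intro: poly_approximable_0 poly_approximable_add)

text \<open>The ratio \<open>b / b'\<close> is less than 1, so its powers outweigh the growth of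
  \<open>s\<close>; the price is the passage from \<open>b'\<close> to a smaller
  \<open>b\<close>.\<close>

lemma poly_approximable_poly_mult:
  assumes f: "poly_approximable b' f" and b: "0 \<le> b" "b < b'"
  shows "poly_approximable b (\<lambda>v. poly s (real v) * f v)"
  unfolding poly_approximable_def
proof (intro allI impI)
  fix \<epsilon> :: real assume e: "\<epsilon> > 0"
  obtain C where C: "C > 0" "\<And>v::nat. \<bar>poly s (real v)\<bar> * (b / b') ^ v \<le> C"
    using poly_times_geometric_bounded[of "b / b'" s] b by auto
  from f e C(1) obtain p where p: "\<And>v. b' ^ v * \<bar>f v - poly p (real v)\<bar> \<le> \<epsilon> / C"
    unfolding poly_approximable_def by (meson divide_pos_pos)
  show "\<exists>p. \<forall>v. b ^ v * \<bar>poly s (real v) * f v - poly p (real v)\<bar> \<le> \<epsilon>"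
  proof (intro exI[of _ "s * p"] allI)
    fix v
    have "b ^ v * \<bar>poly s (real v) * f v - poly (s * p) (real v)\<bar>
        = (\<bar>poly s (real v)\<bar> * (b / b') ^ v) * (b' ^ v * \<bar>f v - poly p (real v)\<bar>)"
      using b by (simp add: power_divide right_diff_distrib[symmetric] abs_mult)
    also have "\<dots> \<le> C * (\<epsilon> / C)"
      using C p b by (intro mult_mono) auto
    finally show "b ^ v * \<bar>poly s (real v) * f v - poly (s * p) (real v)\<bar> \<le> \<epsilon>"
      using C(1) by simp
  qed
qed

lemma poly_approximable_limit:
  assumes "0 \<le> b" "\<And>\<epsilon>. \<epsilon> > 0 \<Longrightarrow> \<exists>g. poly_approximable b g \<and> (\<forall>v. b ^ v * \<bar>f v - g v\<bar> \<le> \<epsilon>)"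
  shows "poly_approximable b f"
  unfolding poly_approximable_def
proof (intro allI impI)
  fix \<epsilon> :: real assume "\<epsilon> > 0"
  then have e: "\<epsilon> / 2 > 0" by simp
  from assms(2)[OF e] obtain g where g: "poly_approximable b g" "\<And>v. b ^ v * \<bar>f v - g v\<bar> \<le> \<epsilon> / 2"
    by auto
  from g(1) e obtain p where p: "\<And>v. b ^ v * \<bar>g v - poly p (real v)\<bar> \<le> \<epsilon> / 2"
    unfolding poly_approximable_def by metis
  have "b ^ v * \<bar>f v - poly p (real v)\<bar> \<le> \<epsilon>" for v
  proof -
    have "b ^ v * \<bar>f v - poly p (real v)\<bar> \<le> b ^ v * (\<bar>f v - g v\<bar> + \<bar>g v - poly p (real v)\<bar>)"
      using assms(1) by (intro mult_left_mono) auto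
    also have "\<dots> \<le> \<epsilon>" using g(2)[of v] p[of v] by (simp add: distrib_left)
    finally show ?thesis .
  qed
  then show "\<exists>p. \<forall>v. b ^ v * \<bar>f v - poly p (real v)\<bar> \<le> \<epsilon>" by blast
qed

text \<open>Taylor expansion of \<open>r ^ v\<close> at \<open>r0\<close>: the step width allowed by the weight depends only on
  \<open>\<beta>\<close>, so finitely many steps lead from the constant \<open>1 ^ v\<close> to the indicator \<open>0 ^ v\<close>
  of \<open>0\<close>.\<close>

lemma poly_approximable_power_step:
  assumes r0: "\<And>b. 0 < b \<Longrightarrow> b < \<beta> \<Longrightarrow> poly_approximable b (\<lambda>v. r0 ^ v)"
    and "0 < r0" "r0 \<le> 1" "\<bar>r - r0\<bar> \<le> d" "2 * d \<le> 1 / \<beta> - 1"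
    and b: "0 < b" "b < \<beta>"
  shows "poly_approximable b (\<lambda>v. r ^ v)"
proof (rule poly_approximable_limit)
  show "0 \<le> b" using b by simp
  fix \<epsilon> :: real assume e: "\<epsilon> > 0"
  obtain M where M: "(1 / 2) ^ M < \<epsilon>" using real_arch_pow_inv[OF e, of "1/2"] by auto
  \<comment> \<open>The m-th Taylor term of \<open>r ^ v\<close> at \<open>r0\<close>; as a function
    of v it is a polynomial of degree m times \<open>r0 ^ v\<close>.\<close>
  define t where "t = (\<lambda>m v. real (v choose m) * (r - r0) ^ m * r0 ^ (v - m))"
  have "poly_approximable b (\<lambda>v. \<Sum>m<M. t m v)"
  proof (rule poly_approximable_sum)
    fix m
    obtain b' where b': "b < b'" "b' < \<beta>" using b dense by blast
    have "poly_approximable b (\<lambda>v. poly (Polynomial.smult ((r - r0) ^ m / r0 ^ m) (gbinomial_poly 0 m)) (real v) * r0 ^ v)"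
      by (rule poly_approximable_poly_mult[of b']) (use b b' r0 in auto)
    also have "(\<lambda>v. poly (Polynomial.smult ((r - r0) ^ m / r0 ^ m) (gbinomial_poly 0 m)) (real v) * r0 ^ v) = t m"
    proof
      fix v
      show "poly (Polynomial.smult ((r - r0) ^ m / r0 ^ m) (gbinomial_poly 0 m)) (real v) * r0 ^ v = t m v"
        using \<open>0 < r0\<close>
        by (cases "m \<le> v") (auto simp: t_def poly_gbinomial_poly binomial_gbinomial[symmetric] power_diff not_le binomial_eq_0)
    qed
    finally show "poly_approximable b (t m)" .
  qed (use b in auto)
  moreover have "b ^ v * \<bar>r ^ v - (\<Sum>m<M. t m v)\<bar> \<le> \<epsilon>" for v
  proof -
    have d: "0 \<le> d" using assms(4) by linarith
    have "r ^ v = ((r - r0) + r0) ^ v" by simp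
    also have "\<dots> = (\<Sum>m\<le>v. t m v)" unfolding t_def by (subst binomial_ring) simp
    \<comment> \<open>Padding by zero terms makes the range contain both the full expansion and the
      first \<open>M\<close> terms, without comparing v with \<open>M\<close>.\<close>
    also have "\<dots> = (\<Sum>m<M + Suc v. t m v)"
      by (rule sum.mono_neutral_left) (auto simp: t_def)
    also have "\<dots> = (\<Sum>m<M. t m v) + (\<Sum>m=M..<M + Suc v. t m v)"
      by (metis atLeast0LessThan le0 le_add1 sum.atLeastLessThan_concat)
    finally have "\<bar>r ^ v - (\<Sum>m<M. t m v)\<bar> = \<bar>\<Sum>m=M..<M + Suc v. t m v\<bar>" by simp
    \<comment> \<open>Doubling \<open>d\<close> extracts a factor \<open>(1 / 2) ^ M\<close> from
      the tail, uniformly in v. The doubled sum is at most \<open>(2 * d + r0) ^ v\<close>, which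
      the bound on \<open>d\<close> keeps below the inverse of the weight.\<close>
    also have "\<dots> \<le> (\<Sum>m=M..<M + Suc v. (1 / 2) ^ M * (real (v choose m) * (2 * d) ^ m * r0 ^ (v - m)))"
    proof (intro order_trans[OF sum_abs] sum_mono)
      fix m assume m: "m \<in> {M..<M + Suc v}"
      have "\<bar>r - r0\<bar> ^ m \<le> d ^ m" using assms(4) by (intro power_mono) auto
      also have "d ^ m = (1 / 2) ^ m * (2 * d) ^ m" by (subst power_mult_distrib[symmetric]) simp
      also have "\<dots> \<le> (1 / 2) ^ M * (2 * d) ^ m"
        using m d by (intro mult_right_mono power_decreasing) auto
      finally have "\<bar>r - r0\<bar> ^ m \<le> (1 / 2) ^ M * (2 * d) ^ m" .
      then have "real (v choose m) * \<bar>r - r0\<bar> ^ m * r0 ^ (v - m)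
          \<le> real (v choose m) * ((1 / 2) ^ M * (2 * d) ^ m) * r0 ^ (v - m)"
        using \<open>0 < r0\<close> by (intro mult_right_mono mult_left_mono) auto
      then show "\<bar>t m v\<bar> \<le> (1 / 2) ^ M * (real (v choose m) * (2 * d) ^ m * r0 ^ (v - m))"
        using \<open>0 < r0\<close> by (simp add: t_def abs_mult power_abs mult_ac)
    qed
    also have "\<dots> = (1 / 2) ^ M * (\<Sum>m=M..<M + Suc v. real (v choose m) * (2 * d) ^ m * r0 ^ (v - m))"
      by (simp only: sum_distrib_left)
    also have "\<dots> \<le> (1 / 2) ^ M * (\<Sum>m<M + Suc v. real (v choose m) * (2 * d) ^ m * r0 ^ (v - m))"
      using d \<open>0 < r0\<close> by (intro mult_left_mono sum_mono2) auto
    also have "(\<Sum>m<M + Suc v. real (v choose m) * (2 * d) ^ m * r0 ^ (v - m))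
        = (\<Sum>m\<le>v. real (v choose m) * (2 * d) ^ m * r0 ^ (v - m))"
      by (rule sum.mono_neutral_right) auto
    also have "\<dots> = (2 * d + r0) ^ v" by (subst binomial_ring) simp
    finally have "b ^ v * \<bar>r ^ v - (\<Sum>m<M. t m v)\<bar> \<le> b ^ v * ((1 / 2) ^ M * (2 * d + r0) ^ v)"
      using b by (intro mult_left_mono) auto
    also have "\<dots> = (1 / 2) ^ M * (b * (2 * d + r0)) ^ v" by (simp add: power_mult_distrib)
    also have "\<dots> \<le> (1 / 2) ^ M * 1"
    proof (intro mult_left_mono power_le_one)
      have "b * (2 * d + r0) \<le> \<beta> * (1 / \<beta>)"
        using assms d by (intro mult_mono) auto
      then show "b * (2 * d + r0) \<le> 1" using b by simp
    qed (use b d \<open>0 < r0\<close> in auto)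
    finally show ?thesis using M by simp
  qed
  ultimately show "\<exists>g. poly_approximable b g \<and> (\<forall>v. b ^ v * \<bar>r ^ v - g v\<bar> \<le> \<epsilon>)" by blast
qed

lemma poly_approximable_delta_0:
  assumes b: "0 < b" "b < 1"
  shows "poly_approximable b (\<lambda>v. 0 ^ v)"
proof -
  define \<beta> where "\<beta> = (1 + b) / 2"
  define d where "d = (1 / \<beta> - 1) / 2"
  have \<beta>: "b < \<beta>" "0 < \<beta>" "\<beta> < 1" using b by (auto simp: \<beta>_def)
  have d: "d > 0" using \<beta> by (simp add: d_def)
  \<comment> \<open>Every step spends part of the room below \<open>\<beta>\<close>, so the claim is
    kept for all \<open>b < \<beta>\<close>. Clipping at 0 makes the walk end exactly at base 0 and
    never lengthens a step.\<close>
  have approx: "poly_approximable b (\<lambda>v. (max 0 (1 - real n * d)) ^ v)" if "0 < b" "b < \<beta>" for n b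
    using that
  proof (induction n arbitrary: b)
    case 0
    show ?case unfolding poly_approximable_def by (intro allI impI exI[of _ 1]) auto
  next
    case (Suc n)
    show ?case
    proof (cases "1 - real n * d > 0")
      case True
      show ?thesis
      proof (rule poly_approximable_power_step[OF Suc.IH, where d = d])
        show "2 * d \<le> 1 / \<beta> - 1" by (simp add: d_def)
        show "\<bar>max 0 (1 - real (Suc n) * d) - max 0 (1 - real n * d)\<bar> \<le> d"
          using True d by (auto simp: max_def algebra_simps)
      qed (use True d Suc.prems in auto)
    next
      case False
      then have "max 0 (1 - real (Suc n) * d) = max 0 (1 - real n * d)"
        using d by (auto simp: max_def algebra_simps)
      then show ?thesis using Suc by simp
    qed
  qed
  obtain n where "real n * d > 1" using d by (metis mult.commute reals_Archimedean3)
  then have "max 0 (1 - real n * d) = 0" by simp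
  then show ?thesis using approx[OF b(1) \<beta>(1), of n] by simp
qed

lemma poly_approximable_delta:
  assumes b: "0 < b" "b < 1"
  shows "poly_approximable b (\<lambda>v. if v = v0 then 1 else 0)"
  unfolding poly_approximable_def
proof (intro allI impI)
  fix \<epsilon> :: real assume e: "\<epsilon> > 0"
  obtain b' where b': "b < b'" "b' < 1" using b dense by blast
  \<comment> \<open>The polynomial v choose v0 vanishes at the naturals below v0 and equals 1 at v0;
    times an approximation of the indicator of 0, shifted by v0, it handles both sides of
    v0.\<close>
  let ?s = "gbinomial_poly 0 v0"
  obtain C where C: "C > 0" "\<And>v::nat. \<bar>poly ?s (real v)\<bar> * (b / b') ^ v \<le> C"
    using poly_times_geometric_bounded[of "b / b'" ?s] b b' by auto
  have "poly_approximable b' (\<lambda>v. 0 ^ v)" using b b' by (intro poly_approximable_delta_0) auto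
  then obtain p where p: "\<And>v. b' ^ v * \<bar>0 ^ v - poly p (real v)\<bar> \<le> \<epsilon> / C"
    unfolding poly_approximable_def using e C(1) by (meson divide_pos_pos)
  show "\<exists>p. \<forall>v. b ^ v * \<bar>(if v = v0 then 1 else 0) - poly p (real v)\<bar> \<le> \<epsilon>"
  proof (intro exI[of _ "?s * (p \<circ>\<^sub>p [:- real v0, 1:])"] allI)
    fix v
    have s: "poly ?s (real v) = real (v choose v0)"
      by (simp add: poly_gbinomial_poly binomial_gbinomial)
    show "b ^ v * \<bar>(if v = v0 then 1 else 0) - poly (?s * (p \<circ>\<^sub>p [:- real v0, 1:])) (real v)\<bar> \<le> \<epsilon>"
    proof (cases "v < v0")
      case True
      then show ?thesis using s e by (simp add: poly_pcompose binomial_eq_0)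
    next
      case False
      define w where "w = v - v0"
      have v: "v = w + v0" using False by (simp add: w_def)
      have "b ^ v * \<bar>(if v = v0 then 1 else 0) - poly (?s * (p \<circ>\<^sub>p [:- real v0, 1:])) (real v)\<bar>
          = b ^ v * \<bar>poly ?s (real v) * (0 ^ w - poly p (real w))\<bar>"
        using s by (auto simp: v poly_pcompose power_0_left right_diff_distrib)
      also have "\<dots> = (\<bar>poly ?s (real v)\<bar> * (b / b') ^ v) * (b' ^ v * \<bar>0 ^ w - poly p (real w)\<bar>)"
        using b b' by (simp add: power_divide abs_mult)
      also have "\<dots> \<le> C * (b' ^ w * \<bar>0 ^ w - poly p (real w)\<bar>)"
        using C(1) C(2)[of v] b b' by (intro mult_mono mult_right_mono power_decreasing) (simp_all add: v)
      also have "\<dots> \<le> C * (\<epsilon> / C)" using p[of w] C(1) by (intro mult_left_mono) auto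
      finally show ?thesis using C(1) by simp
    qed
  qed
qed

lemma delta_approximable_by_polys_l2:
  fixes \<mu> :: "nat \<Rightarrow> real" and s :: "real poly"
  assumes a: "0 < a" "a < 1" and \<mu>: "\<And>v. 0 \<le> \<mu> v" "\<And>v. \<mu> v \<le> \<bar>poly s (real v)\<bar> * a ^ v"
    and e: "\<epsilon> > 0"
  obtains p where "summable (\<lambda>v. \<mu> v * ((if v = v0 then 1 else 0) - poly p (real v))\<^sup>2)"
    "(\<Sum>v. \<mu> v * ((if v = v0 then 1 else 0) - poly p (real v))\<^sup>2) < \<epsilon>"
proof -
  \<comment> \<open>With the fourth root of \<open>a\<close>, one power \<open>b ^ v\<close> absorbs
    \<open>s\<close>, two weight the squared error, and the last one makes the bound
    summable.\<close>
  define b where "b = sqrt (sqrt a)"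
  have b: "0 < b" "b < 1" using a by (auto simp: b_def)
  have ab: "a = b * b * (b * b)" using a by (simp add: b_def)
  obtain C where C: "C > 0" "\<And>v::nat. \<bar>poly s (real v)\<bar> * b ^ v \<le> C"
    using poly_times_geometric_bounded[of b s] b by auto
  \<comment> \<open>Chosen so that the geometric bound sums to half of
    \<open>\<epsilon>\<close>.\<close>
  define \<eta> where "\<eta> = sqrt (\<epsilon> * (1 - b) / (2 * C))"
  have \<eta>: "\<eta> > 0" "\<eta>\<^sup>2 = \<epsilon> * (1 - b) / (2 * C)" using e b C(1) by (auto simp: \<eta>_def)
  obtain p where p: "\<And>v. b ^ v * \<bar>(if v = v0 then 1 else 0) - poly p (real v)\<bar> \<le> \<eta>"
    using poly_approximable_delta[OF b, of v0] \<eta>(1) unfolding poly_approximable_def by metis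
  let ?f = "\<lambda>v. \<mu> v * ((if v = v0 then 1 else 0) - poly p (real v))\<^sup>2"
  have f0: "0 \<le> ?f v" for v using \<mu>(1) by simp
  have f: "?f v \<le> (C * \<eta>\<^sup>2) * b ^ v" for v
  proof -
    let ?e = "(if v = v0 then 1 else 0) - poly p (real v)"
    have "?f v \<le> \<bar>poly s (real v)\<bar> * a ^ v * ?e\<^sup>2" using \<mu>(2) by (intro mult_right_mono) auto
    also have "\<dots> = (\<bar>poly s (real v)\<bar> * b ^ v) * (b ^ v * \<bar>?e\<bar>)\<^sup>2 * b ^ v"
      by (simp add: ab power_mult_distrib power2_eq_square mult_ac)
    also have "\<dots> \<le> C * \<eta>\<^sup>2 * b ^ v"
      using C p[of v] b by (intro mult_right_mono mult_mono power_mono) auto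
    finally show ?thesis .
  qed
  have g: "summable (\<lambda>v. (C * \<eta>\<^sup>2) * b ^ v)" using b by (intro summable_mult summable_geometric) auto
  have sf: "summable ?f" by (rule summable_comparison_test'[OF g, of 0]) (use f f0 in auto)
  have "(\<Sum>v. ?f v) \<le> (\<Sum>v. (C * \<eta>\<^sup>2) * b ^ v)" by (rule suminf_le[OF f sf g])
  also have "\<dots> = C * \<eta>\<^sup>2 * (1 / (1 - b))"
    using b by (subst suminf_mult) (auto simp: suminf_geometric summable_geometric)
  also have "\<dots> = \<epsilon> / 2" using b C(1) \<eta>(2) by (simp add: field_simps)
  also have "\<dots> < \<epsilon>" using e by simp
  finally show ?thesis using sf that by blast
qed

subsection \<open>Expansions at zero and at infinity\<close>

text \<open>The coefficients of \<open>t ^ v\<close> in the expansions of \<open>(1 + t / a) ^ y * (1 + t) powr (N - y)\<close>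
  at \<open>0\<close> and at infinity; the latter is a power series in \<open>1 / t\<close> times \<open>t ^ N\<close>.\<close>

definition coeff_at_0 :: "real \<Rightarrow> nat \<Rightarrow> nat \<Rightarrow> int \<Rightarrow> real" where
  "coeff_at_0 a N y v = (if 0 \<le> v then
     fps_nth ((1 + fps_const (1 / a) * fps_X) ^ y * fps_binomial (real N - real y)) (nat v) else 0)"

definition coeff_at_inf :: "real \<Rightarrow> nat \<Rightarrow> nat \<Rightarrow> int \<Rightarrow> real" where
  "coeff_at_inf a N y v = (if v \<le> int N then
     fps_nth ((fps_const (1 / a) + fps_X) ^ y * fps_binomial (real N - real y)) (nat (int N - v)) else 0)"

lemma fps_nth_linear_power:
  "fps_nth ((1 + fps_const c * fps_X) ^ y) i = real (y choose i) * c ^ i"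
proof (induction y arbitrary: i)
  case (Suc y)
  have "fps_nth ((1 + fps_const c * fps_X) ^ Suc y) i
      = fps_nth ((1 + fps_const c * fps_X) ^ y) i + c * fps_nth (fps_X * (1 + fps_const c * fps_X) ^ y) i"
    by (simp add: distrib_right mult.assoc)
  then show ?case by (cases i) (simp_all add: Suc.IH distrib_left distrib_right)
qed (simp add: binomial_eq_0 power_0_left)

lemma fps_nth_linear_power_times_binomial:
  "fps_nth ((1 + fps_const c * fps_X) ^ y * fps_binomial e) n
    = (\<Sum>j\<le>n. c ^ j * (real y gchoose j) * (e gchoose (n - j)))"
  unfolding fps_mult_nth fps_nth_linear_power fps_binomial_nth
  by (simp add: atLeast0AtMost binomial_gbinomial mult_ac)

text \<open>The defining sum is the Cauchy product of the series of (1 + t/a)^y and (1 +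
  t)^(N-y).\<close>

lemma meixner_eq_coeff_at_0:
  "meixner a (- real N) n (real y) = (a / (1 - a)) ^ n * coeff_at_0 a N y (int n)"
proof -
  have "- real y - - real N = real N - real y" by simp
  then show ?thesis unfolding meixner_def coeff_at_0_def
    by (simp only: fps_nth_linear_power_times_binomial power_divide) simp
qed

text \<open>In s = 1/t the expansion at infinity is t^N (1/a + s)^y (1 + s)^(N-y). Since (1 + a s)^y
  = a^y (1/a + s)^y, replacing a by 1/a in the generating function amounts to expanding at infinity,
  and degree f corresponds to t^(N-f).\<close>

lemma meixner_inverse_eq_coeff_at_inf:
  assumes "0 < a" "a < 1"
  shows "meixner (1 / a) (- real N) f (real y) = (1 / (a - 1)) ^ f * a ^ y * coeff_at_inf a N y (int N - int f)"
proof -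
  have eq: "fps_const (1 / a) + fps_X = fps_const (1 / a) * (1 + fps_const a * fps_X)"
    using assms by (simp add: distrib_left mult.assoc[symmetric])
  have "coeff_at_inf a N y (int N - int f)
      = fps_nth (fps_const ((1 / a) ^ y) * ((1 + fps_const a * fps_X) ^ y * fps_binomial (real N - real y))) f"
    unfolding coeff_at_inf_def eq power_mult_distrib fps_const_power mult.assoc by simp
  then have "a ^ y * coeff_at_inf a N y (int N - int f)
      = (\<Sum>j\<le>f. a ^ j * (real y gchoose j) * ((real N - real y) gchoose (f - j)))"
    using assms by (simp add: fps_nth_linear_power_times_binomial power_divide)
  moreover have "(1 / a) / (1 - 1 / a) = 1 / (a - 1)"
    using assms by (simp add: field_simps)
  then have "(1 / a) ^ f / (1 - 1 / a) ^ f = (1 / (a - 1)) ^ f"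
    by (metis power_divide)
  moreover have "- real y - - real N = real N - real y" by simp
  moreover have "1 / (1 / a) = a" by simp
  ultimately show ?thesis
    unfolding meixner_def by (simp only: mult.assoc)
qed

text \<open>The coefficients of t^v in (1 + t)^e are \<open>gbinomial_int e v\<close> at 0 and
  \<open>gbinomial_int e (e - v)\<close> at infinity; integer indices let both be compared at the
  same v.\<close>

definition gbinomial_int :: "int \<Rightarrow> int \<Rightarrow> real" where
  "gbinomial_int e v = (if 0 \<le> v then of_int e gchoose nat v else 0)"

text \<open>Expanding \<open>(1 + t / a) ^ y\<close> in powers of \<open>1 + t\<close> reduces everything to powers of \<open>1 + t\<close>,
  of which only the negative ones have different expansions at \<open>0\<close> and at infinity.\<close>

definition expansion_coeff :: "real \<Rightarrow> nat \<Rightarrow> nat \<Rightarrow> real" where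
  "expansion_coeff a y i = real (y choose i) * (1 / a) ^ i * (1 - 1 / a) ^ (y - i)"

text \<open>The range of i selects the negative exponents N - y + i; a pole of order y - N - i at -1
  contributes degree y - N - i - 1.\<close>

definition jump_poly :: "real \<Rightarrow> nat \<Rightarrow> nat \<Rightarrow> real poly" where
  "jump_poly a N y = (\<Sum>i<y - N. Polynomial.smult (expansion_coeff a y i)
     (gbinomial_poly (real (y - N - Suc i)) (y - N - Suc i)))"

text \<open>For e >= 0 both expansions are the same finite sum. For e = -1 - m the expansion at 0
  lives on v >= 0, the one at infinity on v <= e, and the polynomial (v + m) choose m vanishes in
  the gap between them.\<close>

lemma gbinomial_int_reflect:
  "gbinomial_int e v - gbinomial_int e (e - v) =
    (if 0 \<le> e then 0 else (- 1) powi v * ((of_int v + real (nat (- e - 1))) gchoose nat (- e - 1)))"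
proof (cases "0 \<le> e")
  case True
  then obtain n where e: "e = int n" by (metis nonneg_int_cases)
  show ?thesis
  proof (cases "0 \<le> v \<and> v \<le> e")
    case True
    then obtain m where v: "v = int m" "m \<le> n" using e by (metis nonneg_int_cases zle_int)
    then show ?thesis
      by (simp add: gbinomial_int_def e binomial_gbinomial[symmetric] nat_diff_distrib binomial_symmetric[symmetric])
  next
    case False
    then show ?thesis using e
      by (auto simp: gbinomial_int_def binomial_gbinomial[symmetric] nat_less_iff)
  qed
next
  case False
  define m where "m = nat (- e - 1)"
  have e: "e = - 1 - int m" using False by (simp add: m_def)
  have neg: "(- 1 - real m) gchoose k = (- 1) ^ k * real ((m + k) choose m)" for k
  proof -
    have "(- 1 - real m) gchoose k = (- 1) ^ k * ((real k - (- 1 - real m) - 1) gchoose k)"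
      by (rule gbinomial_negated_upper)
    also have "real k - (- 1 - real m) - 1 = real (m + k)" by simp
    also have "(m + k) choose k = (m + k) choose m"
      using binomial_symmetric[of k "m + k"] by simp
    then have "real (m + k) gchoose k = real ((m + k) choose m)"
      by (metis binomial_gbinomial)
    finally show ?thesis .
  qed
  consider (pos) "0 \<le> v" | (mid) "v < 0" "e < v" | (neg) "v \<le> e" by linarith
  then show ?thesis
  proof cases
    case pos
    then obtain k where v: "v = int k" by (metis nonneg_int_cases)
    show ?thesis
      using neg[of k] e v by (simp add: gbinomial_int_def binomial_gbinomial add.commute)
  next
    case mid
    define k where "k = nat (v + int m)"
    have k: "v + int m = int k" "k < m" using mid e by (auto simp: k_def)
    have "(of_int v + real m) = real k" using k(1) by (metis of_int_add of_int_of_nat_eq)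
    then have "(of_int v + real m) gchoose m = 0" using k(2) by (simp add: binomial_gbinomial[symmetric])
    then show ?thesis using mid e by (simp add: gbinomial_int_def)
  next
    case neg': neg
    define k where "k = nat (e - v)"
    have v: "v = - 1 - int m - int k" using neg' e by (simp add: k_def)
    have "(of_int v + real m) gchoose m = (- 1) ^ m * ((real m - (of_int v + real m) - 1) gchoose m)"
      by (rule gbinomial_negated_upper)
    also have "real m - (of_int v + real m) - 1 = real (m + k)" by (simp add: v)
    finally have 1: "(of_int v + real m) gchoose m = (- 1) ^ m * real ((m + k) choose m)"
      by (simp add: binomial_gbinomial)
    have v': "v = - int (1 + m + k)" using v by simp
    have "(- 1 :: real) powi v = inverse (- 1) ^ (1 + m + k)"
      by (simp only: v' power_int_minus power_int_of_nat power_inverse)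
    then have "(- 1 :: real) powi v = (- 1) ^ (1 + m + k)" by simp
    then have "(- 1) powi v * ((of_int v + real m) gchoose m) = - ((- 1) ^ k * real ((m + k) choose m))"
      unfolding 1 by (simp add: power_add mult.assoc[symmetric] power_mult_distrib[symmetric])
    then show ?thesis using False neg' neg[of k]
      by (simp add: gbinomial_int_def e v)
  qed
qed

lemma coeff_at_0_expansion:
  "coeff_at_0 a N y v = (\<Sum>i\<le>y. expansion_coeff a y i * gbinomial_int (int N - int y + int i) v)"
proof (cases "0 \<le> v")
  case True
  have "(1 + fps_const (1 / a) * fps_X :: real fps) = fps_const (1 / a) * fps_binomial 1 + fps_const (1 - 1 / a)"
    by (simp add: fps_binomial_1 fps_eq_iff)
  then have "(1 + fps_const (1 / a) * fps_X) ^ y * fps_binomial (real N - real y)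
      = (\<Sum>i\<le>y. of_nat (y choose i) * (fps_const (1 / a) * fps_binomial 1) ^ i * fps_const (1 - 1 / a) ^ (y - i))
        * fps_binomial (real N - real y)"
    by (simp only: binomial_ring)
  also have "\<dots> = (\<Sum>i\<le>y. fps_const (expansion_coeff a y i) * fps_binomial (real_of_int (int N - int y + int i)))"
    unfolding sum_distrib_right
  proof (rule sum.cong[OF refl])
    fix i
    have "fps_binomial (real_of_int (int N - int y + int i)) = fps_binomial 1 ^ i * fps_binomial (real N - real y)"
      by (simp add: fps_binomial_power fps_binomial_add_mult[symmetric] add.commute)
    then show "of_nat (y choose i) * (fps_const (1 / a) * fps_binomial 1) ^ i * fps_const (1 - 1 / a) ^ (y - i)
        * fps_binomial (real N - real y)
      = fps_const (expansion_coeff a y i) * fps_binomial (real_of_int (int N - int y + int i))"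
      by (simp add: expansion_coeff_def power_mult_distrib fps_const_power fps_of_nat[symmetric]
          fps_const_mult[symmetric] mult_ac del: fps_const_mult)
  qed
  finally show ?thesis using True
    by (simp add: coeff_at_0_def gbinomial_int_def fps_sum_nth)
qed (simp add: coeff_at_0_def gbinomial_int_def)

text \<open>In s = 1/t the splitting reads 1/a + s = (1/a)(1 + s) + (1 - 1/a) s; the extra s^(y-i)
  shifts the index to the reflected one.\<close>

lemma coeff_at_inf_expansion:
  "coeff_at_inf a N y v = (\<Sum>i\<le>y. expansion_coeff a y i *
     gbinomial_int (int N - int y + int i) (int N - int y + int i - v))"
proof (cases "v \<le> int N")
  case True
  define f where "f = nat (int N - v)"
  have v: "v = int N - int f" using True by (simp add: f_def)
  have "(fps_const (1 / a) + fps_X :: real fps) = fps_const (1 / a) * fps_binomial 1 + fps_const (1 - 1 / a) * fps_X"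
    by (simp add: fps_binomial_1 fps_eq_iff algebra_simps)
  then have "(fps_const (1 / a) + fps_X) ^ y * fps_binomial (real N - real y)
      = (\<Sum>i\<le>y. of_nat (y choose i) * (fps_const (1 / a) * fps_binomial 1) ^ i * (fps_const (1 - 1 / a) * fps_X) ^ (y - i))
        * fps_binomial (real N - real y)"
    by (simp only: binomial_ring)
  also have "\<dots> = (\<Sum>i\<le>y. fps_const (expansion_coeff a y i) *
      (fps_X ^ (y - i) * fps_binomial (real_of_int (int N - int y + int i))))"
    unfolding sum_distrib_right
  proof (rule sum.cong[OF refl])
    fix i
    have "fps_binomial (real_of_int (int N - int y + int i)) = fps_binomial 1 ^ i * fps_binomial (real N - real y)"
      by (simp add: fps_binomial_power fps_binomial_add_mult[symmetric] add.commute)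
    then show "of_nat (y choose i) * (fps_const (1 / a) * fps_binomial 1) ^ i * (fps_const (1 - 1 / a) * fps_X) ^ (y - i)
        * fps_binomial (real N - real y)
      = fps_const (expansion_coeff a y i) * (fps_X ^ (y - i) * fps_binomial (real_of_int (int N - int y + int i)))"
      by (simp add: expansion_coeff_def power_mult_distrib fps_const_power fps_of_nat[symmetric]
          fps_const_mult[symmetric] mult_ac del: fps_const_mult)
  qed
  finally have "coeff_at_inf a N y v = (\<Sum>i\<le>y. expansion_coeff a y i *
      fps_nth (fps_X ^ (y - i) * fps_binomial (real_of_int (int N - int y + int i))) f)"
    using True by (simp add: coeff_at_inf_def f_def fps_sum_nth)
  also have "\<dots> = (\<Sum>i\<le>y. expansion_coeff a y i *
     gbinomial_int (int N - int y + int i) (int N - int y + int i - v))"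
  proof (rule sum.cong[OF refl])
    fix i assume "i \<in> {..y}"
    then have iy: "i \<le> y" by simp
    show "expansion_coeff a y i * fps_nth (fps_X ^ (y - i) * fps_binomial (real_of_int (int N - int y + int i))) f
      = expansion_coeff a y i * gbinomial_int (int N - int y + int i) (int N - int y + int i - v)"
    proof (cases "f < y - i")
      case True
      then show ?thesis by (simp add: fps_X_power_mult_nth gbinomial_int_def v)
    next
      case False
      then have "nat (int N - int y + int i - v) = f - (y - i)" using iy by (simp add: v)
      then show ?thesis using False iy by (simp add: fps_X_power_mult_nth gbinomial_int_def v)
    qed
  qed
  finally show ?thesis .
next
  case False
  then show ?thesis by (simp add: coeff_at_inf_def gbinomial_int_def)
qed

lemma coeff_at_0_minus_coeff_at_inf:
  "coeff_at_0 a N y v - coeff_at_inf a N y v = (- 1) powi v * poly (jump_poly a N y) (of_int v)"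
proof -
  let ?g = "\<lambda>i. (of_int v + real (y - N - Suc i)) gchoose (y - N - Suc i)"
  have "coeff_at_0 a N y v - coeff_at_inf a N y v
      = (\<Sum>i\<le>y. expansion_coeff a y i * (gbinomial_int (int N - int y + int i) v
          - gbinomial_int (int N - int y + int i) (int N - int y + int i - v)))"
    by (simp add: coeff_at_0_expansion coeff_at_inf_expansion sum_subtractf right_diff_distrib)
  also have "\<dots> = (\<Sum>i\<le>y. if i < y - N then expansion_coeff a y i * ((- 1) powi v * ?g i) else 0)"
  proof (rule sum.cong[OF refl])
    fix i
    have "nat (- (int N - int y + int i) - 1) = y - N - Suc i" by simp
    then show "expansion_coeff a y i * (gbinomial_int (int N - int y + int i) v
          - gbinomial_int (int N - int y + int i) (int N - int y + int i - v))
        = (if i < y - N then expansion_coeff a y i * ((- 1) powi v * ?g i) else 0)"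
      unfolding gbinomial_int_reflect by auto
  qed
  also have "\<dots> = (\<Sum>i<y - N. expansion_coeff a y i * ((- 1) powi v * ?g i))"
    by (subst sum.inter_filter[symmetric]) (auto intro!: sum.cong)
  also have "\<dots> = (- 1) powi v * poly (jump_poly a N y) (of_int v)"
    by (simp add: jump_poly_def poly_sum poly_gbinomial_poly sum_distrib_left mult_ac)
  finally show ?thesis .
qed

lemma jump_poly_eq_0: "y \<le> N \<Longrightarrow> jump_poly a N y = 0"
  by (simp add: jump_poly_def)

lemma degree_jump_poly: "degree (jump_poly a N y) \<le> y - N - 1"
  unfolding jump_poly_def
  by (intro degree_sum_le) (auto simp: degree_gbinomial_poly intro!: order_trans[OF degree_smult_le])

text \<open>Only the pole of highest order, i = 0, reaches this degree.\<close>

lemma coeff_jump_poly: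
  assumes "N < y"
  shows "coeff (jump_poly a N y) (y - N - 1) = (1 - 1 / a) ^ y / fact (y - N - 1)"
proof -
  have "coeff (jump_poly a N y) (y - N - 1) = (\<Sum>i<y - N. expansion_coeff a y i *
      coeff (gbinomial_poly (real (y - N - Suc i)) (y - N - Suc i)) (y - N - 1))"
    by (simp add: jump_poly_def coeff_sum)
  also have "\<dots> = (\<Sum>i<y - N. if i = 0 then (1 - 1 / a) ^ y / fact (y - N - 1) else 0)"
  proof (rule sum.cong[OF refl])
    fix i assume i: "i \<in> {..<y - N}"
    show "expansion_coeff a y i * coeff (gbinomial_poly (real (y - N - Suc i)) (y - N - Suc i)) (y - N - 1)
      = (if i = 0 then (1 - 1 / a) ^ y / fact (y - N - 1) else 0)"
    proof (cases i)
      case 0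
      then show ?thesis by (simp add: coeff_gbinomial_poly expansion_coeff_def)
    next
      case (Suc j)
      then have "y - N - Suc i < y - N - 1" using i by auto
      then show ?thesis using Suc by (simp add: coeff_eq_0 degree_gbinomial_poly)
    qed
  qed
  also have "\<dots> = (1 - 1 / a) ^ y / fact (y - N - 1)" using assms by simp
  finally show ?thesis .
qed

section \<open>Sums of polynomials against Taylor coefficients at t = -a\<close>

lemma pcompose_shift_one:
  fixes s :: "real poly"
  assumes "degree s \<le> Suc y"
  shows "degree (s - pcompose s [:1, 1:]) \<le> y"
    and "coeff (s - pcompose s [:1, 1:]) y = - real (Suc y) * coeff s (Suc y)"
proof -
  have lin: "coeff ([:1, 1 :: real:] ^ i) j = real (i choose j)" for i j
    by (cases "j \<le> i") (simp_all add: coeff_linear_poly_power coeff_eq_0 degree_linear_power binomial_eq_0)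
  have monom: "pcompose (Polynomial.monom c i) [:1, 1:] = Polynomial.smult c ([:1, 1 :: real:] ^ i)" for c i
    by (simp add: poly_eq_poly_eq_iff[symmetric] poly_pcompose poly_monom fun_eq_iff)
  have "pcompose s [:1, 1:] = pcompose (\<Sum>i\<le>Suc y. Polynomial.monom (coeff s i) i) [:1, 1:]"
    by (simp only: poly_as_sum_of_monoms'[OF assms])
  then have c: "coeff (pcompose s [:1, 1:]) j = (\<Sum>i\<le>Suc y. coeff s i * real (i choose j))" for j
    by (simp only: pcompose_sum monom coeff_sum coeff_smult lin)
  have "(\<Sum>i\<le>y. coeff s i * real (i choose y)) = (\<Sum>i\<le>y. if i = y then coeff s y else 0)"
    by (rule sum.cong) (auto simp: binomial_eq_0)
  then show "coeff (s - pcompose s [:1, 1:]) y = - real (Suc y) * coeff s (Suc y)"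
    by (simp add: c algebra_simps)
  show "degree (s - pcompose s [:1, 1:]) \<le> y"
  proof (rule degree_le, intro allI impI)
    fix j assume "y < j"
    then have "coeff (pcompose s [:1, 1:]) j = (\<Sum>i\<le>Suc y. if i = j then coeff s j else 0)"
      unfolding c by (intro sum.cong) (auto simp: binomial_eq_0)
    also have "\<dots> = coeff s j"
      using assms by (cases "j = Suc y") (auto simp: coeff_eq_0)
    finally show "coeff (s - pcompose s [:1, 1:]) j = 0" by simp
  qed
qed

text \<open>Abel summation: at t = -a, multiplying the series by 1 + t/a amounts to replacing
  \<open>s\<close> by its difference. Partial sums differ by a single boundary term, the one assumed
  to tend to 0.\<close>

lemma sums_by_parts:
  fixes F :: "nat \<Rightarrow> real"
  assumes "(\<lambda>v. (- a) ^ v * (s v - s (Suc v)) * F v) sums S"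
    and "(\<lambda>v. (- a) ^ v * s (Suc v) * F v) \<longlonglongrightarrow> 0" and "a \<noteq> 0"
  shows "(\<lambda>v. (- a) ^ v * s v * (F v + (if v = 0 then 0 else F (v - 1) / a))) sums S"
proof -
  let ?h = "\<lambda>v. (- a) ^ v * s v * (F v + (if v = 0 then 0 else F (v - 1) / a))"
  let ?g = "\<lambda>v. (- a) ^ v * (s v - s (Suc v)) * F v"
  have "(\<Sum>v<Suc M. ?h v) = (\<Sum>v<Suc M. ?g v) + (- a) ^ M * s (Suc M) * F M" for M
    by (induction M) (use \<open>a \<noteq> 0\<close> in \<open>simp_all add: field_simps\<close>)
  moreover have "(\<lambda>M. (\<Sum>v<Suc M. ?g v) + (- a) ^ M * s (Suc M) * F M) \<longlonglongrightarrow> S + 0"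
    by (intro tendsto_add assms(2) LIMSEQ_Suc) (use assms(1) in \<open>simp add: sums_def\<close>)
  ultimately have "(\<lambda>M. \<Sum>v<Suc M. ?h v) \<longlonglongrightarrow> S" by simp
  then show ?thesis unfolding sums_def by (rule LIMSEQ_imp_Suc)
qed

lemma fps_nth_linear_power_times_binomial_Suc:
  "fps_nth ((1 + fps_const c * fps_X) ^ Suc y * fps_binomial e) v
    = fps_nth ((1 + fps_const c * fps_X) ^ y * fps_binomial e) v
      + (if v = 0 then 0 else c * fps_nth ((1 + fps_const c * fps_X) ^ y * fps_binomial e) (v - 1))"
proof -
  let ?F = "(1 + fps_const c * fps_X) ^ y * fps_binomial e"
  have "(1 + fps_const c * fps_X) ^ Suc y * fps_binomial e = ?F + fps_const c * (fps_X * ?F)"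
    by (simp add: algebra_simps)
  then show ?thesis by simp
qed

lemma linear_power_times_binomial_coeff_tendsto_0:
  fixes b c e :: real
  assumes "\<bar>b\<bar> < 1"
  shows "(\<lambda>v. fps_nth ((1 + fps_const c * fps_X) ^ y * fps_binomial e) v * b ^ v) \<longlonglongrightarrow> 0"
proof (induction y)
  case 0
  have "(\<lambda>v. (e gchoose v) * b ^ v) sums (1 + b) powr e" using assms by (rule gen_binomial_real)
  then show ?case using summable_LIMSEQ_zero[OF sums_summable] by simp
next
  case (Suc y)
  let ?F = "\<lambda>v. fps_nth ((1 + fps_const c * fps_X) ^ y * fps_binomial e) v"
  have "(\<lambda>v. ?F (Suc v) * b ^ Suc v + c * b * (?F v * b ^ v)) \<longlonglongrightarrow> 0 + c * b * 0"
    by (intro tendsto_add tendsto_mult tendsto_const Suc LIMSEQ_Suc)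
  then have "(\<lambda>v. fps_nth ((1 + fps_const c * fps_X) ^ Suc y * fps_binomial e) (Suc v) * b ^ Suc v) \<longlonglongrightarrow> 0"
    unfolding fps_nth_linear_power_times_binomial_Suc by (simp add: algebra_simps)
  then show ?case by (rule LIMSEQ_imp_Suc)
qed

lemma poly_times_linear_power_times_binomial_tendsto_0:
  fixes a c e :: real
  assumes "0 < a" "a < 1"
  shows "(\<lambda>v. (- a) ^ v * poly s (real v) * fps_nth ((1 + fps_const c * fps_X) ^ y * fps_binomial e) v) \<longlonglongrightarrow> 0"
proof -
  \<comment> \<open>One square root controls the polynomial, the other the coefficients.\<close>
  define b where "b = sqrt a"
  have b: "0 \<le> b" "b < 1" "- a = b * (- b)" using assms by (auto simp: b_def)
  obtain C where C: "\<And>v::nat. \<bar>poly s (real v)\<bar> * b ^ v \<le> C"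
    using poly_times_geometric_bounded[OF b(1,2), of s] by auto
  have "(\<lambda>v. (poly s (real v) * b ^ v) * (fps_nth ((1 + fps_const c * fps_X) ^ y * fps_binomial e) v * (- b) ^ v)) \<longlonglongrightarrow> 0"
    by (rule lim_null_mult_left_bounded[where B = C])
       (use b C in \<open>auto simp: abs_mult intro!: linear_power_times_binomial_coeff_tendsto_0\<close>)
  moreover have "(- a) ^ v = b ^ v * (- b) ^ v" for v
    by (metis b(3) power_mult_distrib)
  ultimately show ?thesis by (simp only: mult_ac)
qed

text \<open>Each of the y factors 1 + t/a, which vanish at -a, is traded for a difference of
  \<open>s\<close>. After y trades \<open>s\<close> is constant and the binomial series at -a is
  left.\<close>

lemma sum_poly_linear_power_times_binomial:
  fixes a e :: real
  assumes a: "0 < a" "a < 1" and "degree s \<le> y"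
  shows "(\<lambda>v. (- a) ^ v * poly s (real v) * fps_nth ((1 + fps_const (1 / a) * fps_X) ^ y * fps_binomial e) v)
    sums (coeff s y * (- 1) ^ y * fact y * (1 - a) powr e)"
  using \<open>degree s \<le> y\<close>
proof (induction y arbitrary: s)
  case 0
  obtain s0 where s: "s = [:s0:]" using 0 degree_eq_zeroE by auto
  have "(\<lambda>v. s0 * ((e gchoose v) * (- a) ^ v)) sums (s0 * (1 + - a) powr e)"
    using a by (intro sums_mult gen_binomial_real) auto
  then show ?case by (simp add: s mult_ac)
next
  case (Suc y)
  let ?F = "\<lambda>v. fps_nth ((1 + fps_const (1 / a) * fps_X) ^ y * fps_binomial e) v"
  let ?s' = "s - pcompose s [:1, 1:]"
  have shift: "poly (pcompose s [:1, 1:]) (real v) = poly s (real (Suc v))" for v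
    by (simp add: poly_pcompose add.commute)
  have "(\<lambda>v. (- a) ^ v * poly ?s' (real v) * ?F v) sums (coeff ?s' y * (- 1) ^ y * fact y * (1 - a) powr e)"
    by (rule Suc.IH[OF pcompose_shift_one(1)[OF Suc.prems]])
  also have "coeff ?s' y * (- 1) ^ y * fact y * (1 - a) powr e
      = coeff s (Suc y) * (- 1) ^ Suc y * fact (Suc y) * (1 - a) powr e"
    unfolding pcompose_shift_one(2)[OF Suc.prems] by (simp add: algebra_simps)
  finally have "(\<lambda>v. (- a) ^ v * (poly s (real v) - poly s (real (Suc v))) * ?F v) sums
      (coeff s (Suc y) * (- 1) ^ Suc y * fact (Suc y) * (1 - a) powr e)"
    by (simp only: poly_diff shift)
  moreover have "(\<lambda>v. (- a) ^ v * poly s (real (Suc v)) * ?F v) \<longlonglongrightarrow> 0"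
    using poly_times_linear_power_times_binomial_tendsto_0[OF a, of "pcompose s [:1, 1:]"]
    by (simp only: shift)
  ultimately have "(\<lambda>v. (- a) ^ v * poly s (real v) * (?F v + (if v = 0 then 0 else ?F (v - 1) / a))) sums
      (coeff s (Suc y) * (- 1) ^ Suc y * fact (Suc y) * (1 - a) powr e)"
    using a by (intro sums_by_parts) auto
  then show ?case unfolding fps_nth_linear_power_times_binomial_Suc
    by (simp only: mult_1 times_divide_eq_left)
qed

lemma sum_poly_coeff_at_0:
  assumes a: "0 < a" "a < 1" and "degree s \<le> y"
  shows "(\<lambda>v. (- a) ^ v * poly s (real v) * coeff_at_0 a N y (int v))
    sums (coeff s y * (- 1) ^ y * fact y * (1 - a) powr (real N - real y))"
  using sum_poly_linear_power_times_binomial[OF assms, of "real N - real y"]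
  by (simp add: coeff_at_0_def)

subsection \<open>Duality of discrete orthogonal systems\<close>

text \<open>The expanded square behind Bessel's inequality, for indicators; it serves both the rows
  (\<open>dual_orthogonality\<close>) and the columns
  (\<open>orthogonal_system_dense\<close>).\<close>

lemma delta_minus_orthogonal_sum_sums:
  fixes W :: "nat \<Rightarrow> real" and \<phi> :: "'i \<Rightarrow> nat \<Rightarrow> real"
  assumes "finite S"
    and orth: "\<And>i j. i \<in> S \<Longrightarrow> j \<in> S \<Longrightarrow> (\<lambda>w. W w * \<phi> i w * \<phi> j w) sums (if i = j then K i else 0)"
  shows "(\<lambda>w. W w * ((if w = v then 1 else 0) - (\<Sum>i\<in>S. t i * \<phi> i w))\<^sup>2) sums
    (W v - 2 * W v * (\<Sum>i\<in>S. t i * \<phi> i v) + (\<Sum>i\<in>S. (t i)\<^sup>2 * K i))"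
proof -
  have "(\<lambda>w. \<Sum>i\<in>S. \<Sum>j\<in>S. t i * t j * (W w * \<phi> i w * \<phi> j w)) sums
      (\<Sum>i\<in>S. \<Sum>j\<in>S. t i * t j * (if i = j then K i else 0))"
    by (intro sums_sum sums_mult orth)
  also have "(\<Sum>i\<in>S. \<Sum>j\<in>S. t i * t j * (if i = j then K i else 0)) = (\<Sum>i\<in>S. (t i)\<^sup>2 * K i)"
    using \<open>finite S\<close> by (intro sum.cong refl) (simp add: if_distrib power2_eq_square cong: if_cong)
  also have "(\<lambda>w. \<Sum>i\<in>S. \<Sum>j\<in>S. t i * t j * (W w * \<phi> i w * \<phi> j w)) = (\<lambda>w. W w * (\<Sum>i\<in>S. t i * \<phi> i w)\<^sup>2)"
    by (simp add: power2_eq_square sum_product sum_distrib_left mult_ac)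
  finally have sq: "(\<lambda>w. W w * (\<Sum>i\<in>S. t i * \<phi> i w)\<^sup>2) sums (\<Sum>i\<in>S. (t i)\<^sup>2 * K i)" .
  have "(\<lambda>w. if w = v then W v - 2 * W v * (\<Sum>i\<in>S. t i * \<phi> i w) else 0) sums
      (W v - 2 * W v * (\<Sum>i\<in>S. t i * \<phi> i v))"
    using sums_single[of v "\<lambda>w. W v - 2 * W v * (\<Sum>i\<in>S. t i * \<phi> i w)"] by simp
  from sums_add[OF this sq] show ?thesis
    by (rule sums_cong[THEN iffD1, rotated]) (auto simp: power2_eq_square algebra_simps)
qed

section \<open>Closed spans in weighted l2\<close>

definition l2_less :: "(nat \<Rightarrow> real) \<Rightarrow> (nat \<Rightarrow> real) \<Rightarrow> real \<Rightarrow> bool" where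
  "l2_less W f e \<longleftrightarrow> summable (\<lambda>x. W x * (f x)\<^sup>2) \<and> (\<Sum>x. W x * (f x)\<^sup>2) < e"

lemma l2_less_add:
  assumes W: "\<And>x. 0 \<le> W x" and f: "l2_less W f e1" and g: "l2_less W g e2"
  shows "l2_less W (\<lambda>x. f x + g x) (2 * e1 + 2 * e2)"
proof -
  let ?h = "\<lambda>x. 2 * (W x * (f x)\<^sup>2) + 2 * (W x * (g x)\<^sup>2)"
  have sf: "summable (\<lambda>x. W x * (f x)\<^sup>2)" "summable (\<lambda>x. W x * (g x)\<^sup>2)"
    using f g by (auto simp: l2_less_def)
  have sh: "summable ?h" by (intro summable_add summable_mult sf)
  have le: "W x * (f x + g x)\<^sup>2 \<le> ?h x" for x
  proof -
    have "(f x + g x)\<^sup>2 \<le> 2 * (f x)\<^sup>2 + 2 * (g x)\<^sup>2"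
      using zero_le_power2[of "f x - g x"] by (simp add: power2_eq_square algebra_simps)
    from mult_left_mono[OF this W[of x]] show ?thesis by (simp add: algebra_simps)
  qed
  have s: "summable (\<lambda>x. W x * (f x + g x)\<^sup>2)"
    by (rule summable_comparison_test'[OF sh, of 0]) (use le W in auto)
  have "(\<Sum>x. W x * (f x + g x)\<^sup>2) \<le> (\<Sum>x. ?h x)" by (rule suminf_le[OF le s sh])
  also have "\<dots> = 2 * (\<Sum>x. W x * (f x)\<^sup>2) + 2 * (\<Sum>x. W x * (g x)\<^sup>2)"
    using sf by (simp add: suminf_add[symmetric] suminf_mult summable_mult)
  also have "\<dots> < 2 * e1 + 2 * e2" using f g by (auto simp: l2_less_def)
  finally show ?thesis using s by (simp add: l2_less_def)
qed

definition in_l2_closed_span :: "(nat \<Rightarrow> real) \<Rightarrow> ('i \<Rightarrow> nat \<Rightarrow> real) \<Rightarrow> 'i set \<Rightarrow> (nat \<Rightarrow> real) \<Rightarrow> bool" where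
  "in_l2_closed_span W \<phi> V f \<longleftrightarrow>
     (\<forall>\<epsilon>>0. \<exists>S c. finite S \<and> S \<subseteq> V \<and> l2_less W (\<lambda>x. f x - (\<Sum>v\<in>S. c v * \<phi> v x)) \<epsilon>)"

lemma in_l2_closed_span_0: "in_l2_closed_span W \<phi> V (\<lambda>x. 0)"
  unfolding in_l2_closed_span_def l2_less_def
  by (intro allI impI exI[of _ "{}"]) auto

lemma in_l2_closed_span_scale:
  assumes "in_l2_closed_span W \<phi> V f"
  shows "in_l2_closed_span W \<phi> V (\<lambda>x. t * f x)"
proof (cases "t = 0")
  case True
  then show ?thesis by (simp add: in_l2_closed_span_0)
next
  case t: False
  show ?thesis unfolding in_l2_closed_span_def
  proof (intro allI impI)
    fix \<epsilon> :: real assume "\<epsilon> > 0"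
    then have "\<epsilon> / t\<^sup>2 > 0" using t by simp
    with assms obtain S c where S: "finite S" "S \<subseteq> V"
      and l: "l2_less W (\<lambda>x. f x - (\<Sum>v\<in>S. c v * \<phi> v x)) (\<epsilon> / t\<^sup>2)"
      unfolding in_l2_closed_span_def by metis
    have eq: "W x * (t * f x - (\<Sum>v\<in>S. t * c v * \<phi> v x))\<^sup>2 = t\<^sup>2 * (W x * (f x - (\<Sum>v\<in>S. c v * \<phi> v x))\<^sup>2)" for x
      by (simp add: mult.assoc sum_distrib_left[symmetric] right_diff_distrib[symmetric] power_mult_distrib)
    have "l2_less W (\<lambda>x. t * f x - (\<Sum>v\<in>S. (t * c v) * \<phi> v x)) \<epsilon>"
      using l t unfolding l2_less_def eq
      by (simp add: summable_mult suminf_mult pos_less_divide_eq mult.commute)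
    with S show "\<exists>S c. finite S \<and> S \<subseteq> V \<and> l2_less W (\<lambda>x. t * f x - (\<Sum>v\<in>S. c v * \<phi> v x)) \<epsilon>"
      by (intro exI[of _ S] exI[of _ "\<lambda>v. t * c v"] conjI)
  qed
qed

lemma in_l2_closed_span_add:
  assumes W: "\<And>x. 0 \<le> W x"
    and f: "in_l2_closed_span W \<phi> V f" and g: "in_l2_closed_span W \<phi> V g"
  shows "in_l2_closed_span W \<phi> V (\<lambda>x. f x + g x)"
  unfolding in_l2_closed_span_def
proof (intro allI impI)
  fix \<epsilon> :: real assume "\<epsilon> > 0"
  then have e: "\<epsilon> / 4 > 0" by simp
  from f e obtain S c where S: "finite S" "S \<subseteq> V"
    and l1: "l2_less W (\<lambda>x. f x - (\<Sum>v\<in>S. c v * \<phi> v x)) (\<epsilon> / 4)"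
    unfolding in_l2_closed_span_def by metis
  from g e obtain T d where T: "finite T" "T \<subseteq> V"
    and l2: "l2_less W (\<lambda>x. g x - (\<Sum>v\<in>T. d v * \<phi> v x)) (\<epsilon> / 4)"
    unfolding in_l2_closed_span_def by metis
  define c' where "c' = (\<lambda>v. (if v \<in> S then c v else 0) + (if v \<in> T then d v else 0))"
  have sum: "(\<Sum>v\<in>S \<union> T. c' v * \<phi> v x) = (\<Sum>v\<in>S. c v * \<phi> v x) + (\<Sum>v\<in>T. d v * \<phi> v x)" for x
  proof -
    have "(\<Sum>v\<in>S \<union> T. c' v * \<phi> v x)
        = (\<Sum>v\<in>S \<union> T. if v \<in> S then c v * \<phi> v x else 0) + (\<Sum>v\<in>S \<union> T. if v \<in> T then d v * \<phi> v x else 0)"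
      unfolding sum.distrib[symmetric] by (rule sum.cong) (auto simp: c'_def algebra_simps)
    then show ?thesis using S(1) T(1)
      by (simp add: sum.inter_restrict[symmetric] Int_absorb1)
  qed
  have "l2_less W (\<lambda>x. (f x - (\<Sum>v\<in>S. c v * \<phi> v x)) + (g x - (\<Sum>v\<in>T. d v * \<phi> v x)))
      (2 * (\<epsilon> / 4) + 2 * (\<epsilon> / 4))"
    by (rule l2_less_add[OF W l1 l2])
  also have "(\<lambda>x. (f x - (\<Sum>v\<in>S. c v * \<phi> v x)) + (g x - (\<Sum>v\<in>T. d v * \<phi> v x)))
      = (\<lambda>x. f x + g x - (\<Sum>v\<in>S \<union> T. c' v * \<phi> v x))"
    unfolding sum by (simp add: algebra_simps)
  finally have "l2_less W (\<lambda>x. f x + g x - (\<Sum>v\<in>S \<union> T. c' v * \<phi> v x)) \<epsilon>" by simp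
  with S T show "\<exists>S c. finite S \<and> S \<subseteq> V \<and> l2_less W (\<lambda>x. f x + g x - (\<Sum>v\<in>S. c v * \<phi> v x)) \<epsilon>"
    by (intro exI[of _ "S \<union> T"] exI[of _ c'] conjI) auto
qed

lemma in_l2_closed_span_limit:
  assumes W: "\<And>x. 0 \<le> W x"
    and g: "\<And>\<epsilon>. \<epsilon> > 0 \<Longrightarrow> \<exists>g. in_l2_closed_span W \<phi> V g \<and> l2_less W (\<lambda>x. f x - g x) \<epsilon>"
  shows "in_l2_closed_span W \<phi> V f"
  unfolding in_l2_closed_span_def
proof (intro allI impI)
  fix \<epsilon> :: real assume "\<epsilon> > 0"
  then have e: "\<epsilon> / 4 > 0" by simp
  from g[OF this] obtain g where g: "in_l2_closed_span W \<phi> V g" and l1: "l2_less W (\<lambda>x. f x - g x) (\<epsilon> / 4)"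
    by auto
  from g e obtain T d where T: "finite T" "T \<subseteq> V"
    and l2: "l2_less W (\<lambda>x. g x - (\<Sum>v\<in>T. d v * \<phi> v x)) (\<epsilon> / 4)"
    unfolding in_l2_closed_span_def by metis
  from l2_less_add[OF W l1 l2] have "l2_less W (\<lambda>x. f x - (\<Sum>v\<in>T. d v * \<phi> v x)) \<epsilon>" by simp
  with T show "\<exists>S c. finite S \<and> S \<subseteq> V \<and> l2_less W (\<lambda>x. f x - (\<Sum>v\<in>S. c v * \<phi> v x)) \<epsilon>"
    by (intro exI[of _ T] exI[of _ d] conjI)
qed

text \<open>\<open>parseval\<close> is equality in Bessel's inequality for the indicator of a point.
  It puts all indicators, hence all truncations of f, into the closed span, and the tails of f are
  small.\<close>

lemma orthogonal_system_dense:
  fixes \<phi> :: "nat \<Rightarrow> nat \<Rightarrow> real"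
  assumes W: "\<And>x. 0 < W x"
    and orth: "\<And>i j. i \<in> V \<Longrightarrow> j \<in> V \<Longrightarrow> (\<lambda>x. W x * \<phi> i x * \<phi> j x) sums (if i = j then K i else 0)"
    and K: "\<And>i. i \<in> V \<Longrightarrow> 0 < K i"
    and parseval: "\<And>x. (\<lambda>n. if n \<in> V then (\<phi> n x)\<^sup>2 / K n else 0) sums (1 / W x)"
    and f: "summable (\<lambda>x. W x * (f x)\<^sup>2)"
  shows "in_l2_closed_span W \<phi> V f"
proof -
  have W0: "0 \<le> W x" for x using W[of x] by simp
  have delta: "in_l2_closed_span W \<phi> V (\<lambda>x. if x = x0 then 1 else 0)" for x0
    unfolding in_l2_closed_span_def
  proof (intro allI impI)
    fix \<epsilon> :: real assume e: "\<epsilon> > 0"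
    let ?a = "\<lambda>n. if n \<in> V then (\<phi> n x0)\<^sup>2 / K n else 0"
    have "(\<lambda>N. \<Sum>n<N. ?a n) \<longlonglongrightarrow> 1 / W x0" using parseval by (simp add: sums_def)
    then have "(\<lambda>N. W x0 - (W x0)\<^sup>2 * (\<Sum>n<N. ?a n)) \<longlonglongrightarrow> W x0 - (W x0)\<^sup>2 * (1 / W x0)"
      by (intro tendsto_intros)
    also have "W x0 - (W x0)\<^sup>2 * (1 / W x0) = 0" using W[of x0] by (simp add: power2_eq_square)
    finally have "eventually (\<lambda>N. W x0 - (W x0)\<^sup>2 * (\<Sum>n<N. ?a n) < \<epsilon>) sequentially"
      using e by (rule order_tendstoD)
    then obtain N where N: "W x0 - (W x0)\<^sup>2 * (\<Sum>n<N. ?a n) < \<epsilon>"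
      by (auto simp: eventually_sequentially)
    define S where "S = {n. n < N \<and> n \<in> V}"
    have S: "finite S" "S \<subseteq> V" by (auto simp: S_def)
    \<comment> \<open>Fourier coefficients of the indicator of \<open>x0\<close>.\<close>
    let ?t = "\<lambda>i. W x0 * \<phi> i x0 / K i"
    have "(\<lambda>w. W w * ((if w = x0 then 1 else 0) - (\<Sum>i\<in>S. ?t i * \<phi> i w))\<^sup>2) sums
        (W x0 - 2 * W x0 * (\<Sum>i\<in>S. ?t i * \<phi> i x0) + (\<Sum>i\<in>S. (?t i)\<^sup>2 * K i))"
      by (rule delta_minus_orthogonal_sum_sums[OF S(1)]) (use S(2) orth in blast)
    also have "(\<Sum>i\<in>S. (?t i)\<^sup>2 * K i) = W x0 * (\<Sum>i\<in>S. ?t i * \<phi> i x0)"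
      unfolding sum_distrib_left
      by (rule sum.cong) (use K in \<open>auto simp: S_def power2_eq_square less_imp_neq field_simps\<close>)
    also have "(\<Sum>i\<in>S. ?t i * \<phi> i x0) = W x0 * (\<Sum>n\<in>S. ?a n)"
      unfolding sum_distrib_left
      by (rule sum.cong) (auto simp: S_def power2_eq_square)
    also have "(\<Sum>n\<in>S. ?a n) = (\<Sum>n<N. ?a n)"
      by (rule sum.mono_neutral_left) (auto simp: S_def)
    also have "W x0 - 2 * W x0 * (W x0 * (\<Sum>n<N. ?a n)) + W x0 * (W x0 * (\<Sum>n<N. ?a n))
        = W x0 - (W x0)\<^sup>2 * (\<Sum>n<N. ?a n)"
      by (simp add: power2_eq_square algebra_simps)
    finally have "l2_less W (\<lambda>x. (if x = x0 then 1 else 0) - (\<Sum>i\<in>S. ?t i * \<phi> i x)) \<epsilon>"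
      using N by (auto simp: l2_less_def sums_iff)
    then show "\<exists>S c. finite S \<and> S \<subseteq> V \<and> l2_less W (\<lambda>x. (if x = x0 then 1 else 0) - (\<Sum>v\<in>S. c v * \<phi> v x)) \<epsilon>"
      using S by (intro exI[of _ S] exI[of _ ?t] conjI)
  qed
  have trunc: "in_l2_closed_span W \<phi> V (\<lambda>x. if x < M then f x else 0)" for M
  proof (induction M)
    case 0
    then show ?case by (simp add: in_l2_closed_span_0)
  next
    case (Suc M)
    have "(\<lambda>x. if x < Suc M then f x else 0)
        = (\<lambda>x. (if x < M then f x else 0) + f M * (if x = M then 1 else 0))"
      by (auto simp: fun_eq_iff less_Suc_eq)
    then show ?case
      by (simp only:) (intro in_l2_closed_span_add[OF W0 Suc] in_l2_closed_span_scale delta)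
  qed
  show ?thesis
  proof (rule in_l2_closed_span_limit[OF W0])
    fix \<epsilon> :: real assume e: "\<epsilon> > 0"
    let ?F = "\<lambda>x. W x * (f x)\<^sup>2"
    obtain M where M: "norm (\<Sum>i. ?F (i + M)) < \<epsilon>"
      using suminf_exist_split[OF e f] by auto
    have "(\<lambda>x. W x * (f x - (if x < M then f x else 0))\<^sup>2) sums (\<Sum>i. ?F (i + M))"
    proof -
      have "(\<lambda>i. W (i + M) * (f (i + M) - (if i + M < M then f (i + M) else 0))\<^sup>2) sums (\<Sum>i. ?F (i + M))"
        using summable_sums[OF summable_ignore_initial_segment[OF f, of M]] by simp
      then show ?thesis by (subst (asm) sums_iff_shift) simp
    qed
    then have "l2_less W (\<lambda>x. f x - (if x < M then f x else 0)) \<epsilon>"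
      using M by (auto simp: l2_less_def sums_iff)
    then show "\<exists>g. in_l2_closed_span W \<phi> V g \<and> l2_less W (\<lambda>x. f x - g x) \<epsilon>"
      using trunc by blast
  qed
qed

section \<open>From orthogonal complete rows to orthogonal columns\<close>

lemma poly_eq_sum_of_graded:
  fixes q :: "nat \<Rightarrow> real poly"
  assumes q: "\<And>x. degree (q x) \<le> x" "\<And>x. coeff (q x) x \<noteq> 0"
    and "degree p < n"
  shows "\<exists>t. p = (\<Sum>x<n. Polynomial.smult (t x) (q x))"
  using \<open>degree p < n\<close>
proof (induction n arbitrary: p)
  case (Suc n)
  define r where "r = p - Polynomial.smult (coeff p n / coeff (q n) n) (q n)"
  have "coeff r n = 0" using q(2)[of n] by (simp add: r_def)
  moreover have "degree r \<le> n" unfolding r_def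
    using Suc.prems q(1)[of n] by (intro degree_diff_le) (auto intro: order_trans[OF degree_smult_le])
  ultimately have r: "degree r < n \<or> r = 0"
    using leading_coeff_0_iff order_less_le by metis
  have "\<exists>t. r = (\<Sum>x<n. Polynomial.smult (t x) (q x))"
  proof (cases "r = 0")
    case True
    then show ?thesis by (intro exI[of _ "\<lambda>x. 0"]) simp
  qed (use r Suc.IH in auto)
  then obtain t where t: "r = (\<Sum>x<n. Polynomial.smult (t x) (q x))" ..
  have "p = (\<Sum>x<Suc n. Polynomial.smult ((t(n := coeff p n / coeff (q n) n)) x) (q x))"
    by (simp add: t[symmetric] r_def)
  then show ?case by (rule exI[where x = "t(n := coeff p n / coeff (q n) n)"])
qed simp

text \<open>An infinite matrix with orthonormal rows has orthonormal columns once the rows are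
  complete; the density of polynomials supplies this, as the \<open>q x\<close> span all
  polynomials.\<close>

lemma dual_orthogonality:
  fixes \<mu> :: "nat \<Rightarrow> real" and q :: "nat \<Rightarrow> real poly"
  assumes \<mu>: "\<And>v. 0 \<le> \<mu> v"
    and q: "\<And>x. degree (q x) \<le> x" "\<And>x. coeff (q x) x \<noteq> 0"
    and orth: "\<And>x y. (\<lambda>v. \<mu> v * poly (q x) (real v) * poly (q y) (real v)) sums (if x = y then K x else 0)"
    and K: "\<And>x. 0 < K x"
    and dense: "\<And>v0 \<epsilon>. \<epsilon> > 0 \<Longrightarrow> \<exists>p. l2_less \<mu> (\<lambda>v. (if v = v0 then 1 else 0) - poly p (real v)) \<epsilon>"
    and v: "0 < \<mu> v" and v': "0 < \<mu> v'"
  shows "(\<lambda>x. poly (q x) (real v) * poly (q x) (real v') / K x) sums (if v = v' then 1 / \<mu> v else 0)"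
proof -
  define c where "c = (\<lambda>x. (poly (q x) (real v))\<^sup>2 / K x)"
  \<comment> \<open>The squared distance of the indicator of v from the span of the first n
    polynomials; \<open>expand\<close> shows that the Fourier coefficients attain it.\<close>
  define E where "E = (\<lambda>n. \<mu> v - (\<mu> v)\<^sup>2 * (\<Sum>x<n. c x))"
  have c0: "0 \<le> c x" for x using K[of x] by (simp add: c_def)
  have expand: "(\<lambda>w. \<mu> w * ((if w = v then 1 else 0) - (\<Sum>x<n. t x * poly (q x) (real w)))\<^sup>2) sums
      (E n + (\<Sum>x<n. K x * (t x - \<mu> v * poly (q x) (real v) / K x)\<^sup>2))" for n t
  proof -
    have sums: "(\<lambda>w. \<mu> w * ((if w = v then 1 else 0) - (\<Sum>x<n. t x * poly (q x) (real w)))\<^sup>2) sums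
      (\<mu> v - 2 * \<mu> v * (\<Sum>x<n. t x * poly (q x) (real v)) + (\<Sum>x<n. (t x)\<^sup>2 * K x))"
      by (rule delta_minus_orthogonal_sum_sums) (use orth in auto)
    have "(\<Sum>x<n. K x * (t x - \<mu> v * poly (q x) (real v) / K x)\<^sup>2)
       = (\<Sum>x<n. (t x)\<^sup>2 * K x - 2 * \<mu> v * (t x * poly (q x) (real v)) + (\<mu> v)\<^sup>2 * c x)"
      by (rule sum.cong) (use K in \<open>auto simp: c_def power2_eq_square field_simps less_imp_neq[THEN not_sym]\<close>)
    then have "(\<Sum>x<n. K x * (t x - \<mu> v * poly (q x) (real v) / K x)\<^sup>2)
       = (\<Sum>x<n. (t x)\<^sup>2 * K x) - 2 * \<mu> v * (\<Sum>x<n. t x * poly (q x) (real v)) + (\<mu> v)\<^sup>2 * (\<Sum>x<n. c x)"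
      by (simp only: sum.distrib sum_subtractf sum_distrib_left[symmetric])
    then have "E n + (\<Sum>x<n. K x * (t x - \<mu> v * poly (q x) (real v) / K x)\<^sup>2)
       = \<mu> v - 2 * \<mu> v * (\<Sum>x<n. t x * poly (q x) (real v)) + (\<Sum>x<n. (t x)\<^sup>2 * K x)"
      unfolding E_def by linarith
    with sums show ?thesis by (simp only:)
  qed
  have best: "(\<lambda>w. \<mu> w * ((if w = v then 1 else 0) - (\<Sum>x<n. \<mu> v * poly (q x) (real v) / K x * poly (q x) (real w)))\<^sup>2) sums E n" for n
    using expand[where n = n and t = "\<lambda>x. \<mu> v * poly (q x) (real v) / K x"] by simp
  have E0: "0 \<le> E n" for n
    by (rule sums_le[OF _ sums_zero best]) (use \<mu> in simp)
  have E_mono: "E n \<le> E m" if "m \<le> n" for m n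
    unfolding E_def using that c0 by (intro diff_left_mono mult_left_mono sum_mono2) auto
  have "E \<longlonglongrightarrow> 0"
  proof (rule LIMSEQ_I)
    fix \<epsilon> :: real assume "\<epsilon> > 0"
    from dense[OF this, of v] obtain p
      where p: "summable (\<lambda>w. \<mu> w * ((if w = v then 1 else 0) - poly p (real w))\<^sup>2)"
        "(\<Sum>w. \<mu> w * ((if w = v then 1 else 0) - poly p (real w))\<^sup>2) < \<epsilon>"
      unfolding l2_less_def by auto
    define m where "m = Suc (degree p)"
    obtain t where t: "p = (\<Sum>x<m. Polynomial.smult (t x) (q x))"
      using poly_eq_sum_of_graded[OF q, of p m] by (auto simp: m_def)
    have "(\<Sum>w. \<mu> w * ((if w = v then 1 else 0) - poly p (real w))\<^sup>2)
        = E m + (\<Sum>x<m. K x * (t x - \<mu> v * poly (q x) (real v) / K x)\<^sup>2)"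
      using expand[where n = m and t = t] by (simp add: sums_iff t poly_sum)
    moreover have "0 \<le> (\<Sum>x<m. K x * (t x - \<mu> v * poly (q x) (real v) / K x)\<^sup>2)"
      using K by (intro sum_nonneg mult_nonneg_nonneg) (auto simp: less_imp_le)
    ultimately have "E m < \<epsilon>" using p(2) by linarith
    then have "\<forall>n\<ge>m. norm (E n - 0) < \<epsilon>" using E_mono E0 by (auto intro: le_less_trans)
    then show "\<exists>no. \<forall>n\<ge>no. norm (E n - 0) < \<epsilon>" ..
  qed
  show ?thesis
  proof (cases "v = v'")
    case True
    have "(\<lambda>n. (\<mu> v - E n) / (\<mu> v)\<^sup>2) \<longlonglongrightarrow> (\<mu> v - 0) / (\<mu> v)\<^sup>2"
      using v by (intro tendsto_intros \<open>E \<longlonglongrightarrow> 0\<close>) auto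
    moreover have "(\<lambda>n. (\<mu> v - E n) / (\<mu> v)\<^sup>2) = (\<lambda>n. \<Sum>x<n. c x)"
      using v by (simp add: E_def)
    ultimately show ?thesis using True v
      by (simp add: sums_def c_def power2_eq_square)
  next
    case False
    define T where "T = (\<lambda>n. \<Sum>x<n. poly (q x) (real v) * poly (q x) (real v') / K x)"
    \<comment> \<open>Only the term at v' of the error series is kept; it already contains the
      partial sum in question.\<close>
    have le: "\<mu> v' * (\<mu> v * T n)\<^sup>2 \<le> E n" for n
    proof -
      let ?f = "\<lambda>w. \<mu> w * ((if w = v then 1 else 0) - (\<Sum>x<n. \<mu> v * poly (q x) (real v) / K x * poly (q x) (real w)))\<^sup>2"
      have "sum ?f {v'} \<le> suminf ?f"
        using best[of n] \<mu> by (intro sum_le_suminf) (auto simp: sums_iff)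
      then show ?thesis
        using best[of n] False by (simp add: T_def sums_iff sum_distrib_left mult_ac)
    qed
    have "(\<lambda>n. (T n)\<^sup>2) \<longlonglongrightarrow> 0"
    proof (rule tendsto_sandwich[of "\<lambda>n. 0"])
      show "eventually (\<lambda>n. (T n)\<^sup>2 \<le> E n / (\<mu> v' * (\<mu> v)\<^sup>2)) sequentially"
        using le v v' by (intro always_eventually allI)
          (simp add: pos_le_divide_eq power_mult_distrib mult_ac)
      have "(\<lambda>n. E n / (\<mu> v' * (\<mu> v)\<^sup>2)) \<longlonglongrightarrow> 0 / (\<mu> v' * (\<mu> v)\<^sup>2)"
        using v v' by (intro tendsto_intros \<open>E \<longlonglongrightarrow> 0\<close>) auto
      then show "(\<lambda>n. E n / (\<mu> v' * (\<mu> v)\<^sup>2)) \<longlonglongrightarrow> 0" by simp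
    qed auto
    then have "T \<longlonglongrightarrow> 0" by simp
    then show ?thesis using False by (simp add: sums_def T_def)
  qed
qed

subsection \<open>Exceptional Meixner polynomials\<close>

lemma prod_linear_factors_dvd:
  fixes g :: "real poly"
  assumes "finite H" "\<And>h. h \<in> H \<Longrightarrow> poly g (of_int h) = 0"
  shows "(\<Prod>h\<in>H. [:- of_int h, 1:]) dvd g"
  using assms
proof (induction H rule: finite_induct)
  case (insert h H)
  then obtain r where r: "g = (\<Prod>h\<in>H. [:- of_int h, 1:]) * r" by (auto elim: dvdE)
  have "poly g (of_int h) = 0" using insert.prems by simp
  moreover have "poly (\<Prod>h\<in>H. [:- of_int h, 1:]) (of_int h :: real) \<noteq> 0"
    using insert.hyps by (auto simp: poly_prod)
  ultimately have "[:- of_int h, 1:] dvd r" by (simp add: r poly_eq_0_iff_dvd)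
  then show ?case unfolding r prod.insert[OF insert.hyps]
    by (subst mult.commute) (rule mult_dvd_mono[OF dvd_refl])
qed simp

lemma coeff_mult_at_degree_bounds:
  fixes p q :: "real poly"
  assumes "degree p \<le> m" "degree q \<le> n"
  shows "coeff (p * q) (m + n) = coeff p m * coeff q n"
proof (cases "degree p = m \<and> degree q = n")
  case True
  then show ?thesis by (auto simp: coeff_mult_degree_sum)
next
  case False
  then have "degree (p * q) < m + n" using degree_mult_le[of p q] assms by linarith
  then show ?thesis using False assms by (auto simp: coeff_eq_0)
qed

text \<open>The least sum is 1 + 2 + ... + card F: a new maximum exceeds the number of smaller
  positive elements.\<close>

lemma card_Suc_choose_2_le_sum:
  fixes F :: "nat set"
  assumes "finite F" "0 \<notin> F"
  shows "(card F + 1) choose 2 \<le> \<Sum>F"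
  using assms
proof (induction F rule: finite_linorder_max_induct)
  case (insert b F)
  have "F \<subseteq> {1..<b}" using insert by (auto simp: Suc_le_eq intro!: gr0I)
  then have "card F \<le> b - 1" using card_mono[of "{1..<b}" F] by simp
  moreover have "b \<noteq> 0" using insert.prems by auto
  ultimately have "card F + 1 \<le> b" by linarith
  moreover have "b \<notin> F" using insert.hyps by auto
  ultimately show ?case using insert
    by (simp add: numeral_2_eq_2)
qed simp

lemma uF_nonneg:
  assumes "finite F1" "finite F2" "0 \<notin> F1" "0 \<notin> F2"
  shows "0 \<le> uF F1 F2"
proof -
  have "card F2 choose 2 \<le> (card F2 + 1) choose 2" by (simp add: numeral_2_eq_2)
  then show ?thesis unfolding uF_def
    using card_Suc_choose_2_le_sum[of F1] card_Suc_choose_2_le_sum[of F2] assms by linarith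
qed

locale exceptional_meixner =
  fixes a :: real and N :: nat and F1 F2 :: "nat set"
  assumes a: "0 < a" "a < 1"
    and fin: "finite F1" "finite F2"
    and cover: "{0..int N} \<subseteq> int ` F1 \<union> (\<lambda>f. int N - int f) ` F2"
    and adm: "admissible (- int N) F1 F2"
begin

text \<open>The exponents v for which the coefficients of t^v at infinity form an F2-row.\<close>

definition "B2 = (\<lambda>f. int N - int f) ` F2"
definition "H = HF (- int N) F1 F2"
definition "k = card F1 + card F2"
abbreviation "Om x \<equiv> Omega a (- real N) F1 F2 (real x)"

lemma H_eq: "H = ((int ` F1 \<union> B2) - {0..int N}) \<union> (int ` F1 \<inter> B2)"
  by (simp add: H_def HF_def B2_def)

lemma finite_H: "finite H"
  using fin by (auto simp: H_eq B2_def)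

text \<open>Inclusion-exclusion, where (C) ensures that removing {0..N} from the union removes all N
  + 1 points.\<close>

lemma card_H: "card H + N + 1 = k"
proof -
  have f: "finite (int ` F1)" "finite B2" using fin by (auto simp: B2_def)
  have "card (int ` F1) = card F1" "card B2 = card F2"
    by (auto simp: B2_def card_image inj_on_def)
  then have "card (int ` F1 \<union> B2) + card (int ` F1 \<inter> B2) = k"
    using card_Un_Int[OF f] by (simp add: k_def)
  moreover have "card (int ` F1 \<union> B2 - {0..int N}) + (N + 1) = card (int ` F1 \<union> B2)"
    using cover f card_mono[of "int ` F1 \<union> B2" "{0..int N}"]
    by (subst card_Diff_subset) (auto simp: B2_def)
  moreover have "card H = card (int ` F1 \<union> B2 - {0..int N}) + card (int ` F1 \<inter> B2)"
    unfolding H_eq using f by (intro card_Un_disjoint) (auto simp: B2_def)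
  ultimately show ?thesis by simp
qed

text \<open>In each case both coefficient combinations vanish at h: exponents above N do not occur
  at infinity, negative ones do not occur at 0, and the rest is forced by rows.\<close>

lemma H_cases:
  assumes "h \<in> H"
  obtains "h \<in> int ` F1" "int N < h" | "h \<in> B2" "h < 0" | "h \<in> int ` F1" "h \<in> B2"
  using assms unfolding H_eq by (auto simp: B2_def)

text \<open>In either case the combination of coefficients at infinity is zero, so outside F1 the
  jump is the whole coefficient at 0.\<close>

lemma not_in_F1_cases:
  assumes "v \<notin> F1"
  obtains "int N < int v" | "int v \<in> B2"
proof (cases "v \<le> N")
  case True
  then have "int v \<in> {0..int N}" by simp
  then have "int v \<in> int ` F1 \<union> B2" using cover unfolding B2_def by blast
  then show ?thesis using assms that by auto
qed (use that in auto)

lemma not_in_F1_imp_not_in_H: "v \<notin> F1 \<Longrightarrow> int v \<notin> H"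
  unfolding H_eq by (auto simp: B2_def)

definition "Hpoly = (\<Prod>h\<in>H. [:- of_int h, 1 :: real:])"

lemma degree_Hpoly: "degree Hpoly = card H"
  and lead_coeff_Hpoly: "coeff Hpoly (card H) = 1"
proof -
  show d: "degree Hpoly = card H" unfolding Hpoly_def
    by (simp add: degree_prod_eq_sum_degree)
  have "lead_coeff Hpoly = 1" unfolding Hpoly_def by (simp add: lead_coeff_prod)
  then show "coeff Hpoly (card H) = 1" by (simp add: d)
qed

lemma poly_Hpoly: "poly Hpoly (of_int v) = of_int (\<Prod>h\<in>H. v - h)"
  by (simp add: Hpoly_def poly_prod)

text \<open>Admissibility gives the sign; strictness holds because \<open>H\<close> contains no
  natural number outside F1.\<close>

lemma poly_Hpoly_pos: "v \<notin> F1 \<Longrightarrow> 0 < poly Hpoly (real v)"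
proof -
  assume v: "v \<notin> F1"
  have "0 \<le> (\<Prod>h\<in>H. int v - h)" using adm v by (simp add: admissible_def H_def)
  moreover have "(\<Prod>h\<in>H. int v - h) \<noteq> 0"
    using not_in_F1_imp_not_in_H[OF v] finite_H by auto
  ultimately have "0 < (\<Prod>h\<in>H. int v - h)" by linarith
  moreover have "poly Hpoly (real v) = of_int (\<Prod>h\<in>H. int v - h)"
    using poly_Hpoly[of "int v"] by (simp only: of_int_of_nat_eq)
  ultimately show ?thesis by (simp only: of_int_0_less_iff)
qed

section \<open>Column combinations that annihilate the rows\<close>

definition "row_entry x = omega_entry a (- real N) F1 F2 (real x)"

lemma row_entry_F1:
  assumes "i < card F1"
  shows "row_entry x i j = (a / (1 - a)) ^ (sorted_list_of_set F1 ! i)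
    * coeff_at_0 a N (x + j) (int (sorted_list_of_set F1 ! i))"
  using meixner_eq_coeff_at_0[of a N _ "x + j"] assms by (simp add: row_entry_def omega_entry_def)

text \<open>The division by a^j in the entry cancels the j-part of a^(x+j), so the prefactor is
  constant along the row.\<close>

lemma row_entry_F2:
  assumes "\<not> i < card F1"
  shows "row_entry x i j = (1 / (a - 1)) ^ (sorted_list_of_set F2 ! (i - card F1)) * a ^ x
    * coeff_at_inf a N (x + j) (int N - int (sorted_list_of_set F2 ! (i - card F1)))"
  using meixner_inverse_eq_coeff_at_inf[OF a, of N _ "x + j"] assms a
  by (simp add: row_entry_def omega_entry_def power_add)

lemma row_entry_Suc: "row_entry x i (Suc j) = (if i < card F1 then 1 else 1 / a) * row_entry (Suc x) i j"
  by (simp add: row_entry_def omega_entry_def algebra_simps)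

text \<open>Used for two vectors: a kernel vector of the matrix of Omega (\<open>J = {..<k}\<close>)
  and the vector of cofactors (\<open>J = {..k}\<close>).\<close>

definition "annihilates J c x \<longleftrightarrow> (\<forall>i<k. (\<Sum>j\<in>J. c j * row_entry x i j) = 0)"

lemma annihilates_F1:
  assumes "annihilates J c x" "f \<in> F1"
  shows "(\<Sum>j\<in>J. c j * coeff_at_0 a N (x + j) (int f)) = 0"
proof -
  obtain i where i: "i < card F1" "sorted_list_of_set F1 ! i = f"
    using assms(2) fin by (metis in_set_conv_nth length_sorted_list_of_set set_sorted_list_of_set)
  then have "(\<Sum>j\<in>J. c j * row_entry x i j) = 0"
    using assms(1) by (simp add: annihilates_def k_def)
  then have "(a / (1 - a)) ^ f * (\<Sum>j\<in>J. c j * coeff_at_0 a N (x + j) (int f)) = 0"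
    using i by (simp add: row_entry_F1 sum_distrib_left mult_ac)
  then show ?thesis using a by simp
qed

lemma annihilates_B2:
  assumes "annihilates J c x" "b \<in> B2"
  shows "(\<Sum>j\<in>J. c j * coeff_at_inf a N (x + j) b) = 0"
proof -
  obtain f where f: "f \<in> F2" "b = int N - int f" using assms(2) by (auto simp: B2_def)
  obtain i where i: "i < card F2" "sorted_list_of_set F2 ! i = f"
    using f(1) fin by (metis in_set_conv_nth length_sorted_list_of_set set_sorted_list_of_set)
  then have "(\<Sum>j\<in>J. c j * row_entry x (card F1 + i) j) = 0"
    using assms(1) by (simp add: annihilates_def k_def)
  then have "((1 / (a - 1)) ^ f * a ^ x) * (\<Sum>j\<in>J. c j * coeff_at_inf a N (x + j) b) = 0"
    using i f by (simp add: row_entry_F2 sum_distrib_left mult_ac)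
  then show ?thesis using a by simp
qed

definition "jump_comb J c x = (\<Sum>j\<in>J. Polynomial.smult (c j) (jump_poly a N (x + j)))"

lemma poly_jump_comb:
  "(- 1) powi v * poly (jump_comb J c x) (of_int v)
    = (\<Sum>j\<in>J. c j * coeff_at_0 a N (x + j) v) - (\<Sum>j\<in>J. c j * coeff_at_inf a N (x + j) v)"
proof -
  have "(- 1) powi v * poly (jump_comb J c x) (of_int v)
      = (\<Sum>j\<in>J. c j * ((- 1) powi v * poly (jump_poly a N (x + j)) (of_int v)))"
    by (simp add: jump_comb_def poly_sum sum_distrib_left mult_ac)
  also have "\<dots> = (\<Sum>j\<in>J. c j * coeff_at_0 a N (x + j) v - c j * coeff_at_inf a N (x + j) v)"
    unfolding coeff_at_0_minus_coeff_at_inf[symmetric] by (simp add: right_diff_distrib)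
  finally show ?thesis by (simp add: sum_subtractf)
qed

lemma Hpoly_dvd_jump_comb:
  assumes "annihilates J c x"
  shows "Hpoly dvd jump_comb J c x"
  unfolding Hpoly_def
proof (rule prod_linear_factors_dvd[OF finite_H])
  fix h assume "h \<in> H"
  then have "(- 1) powi h * poly (jump_comb J c x) (of_int h) = 0"
  proof (cases rule: H_cases)
    case 1
    then show ?thesis unfolding poly_jump_comb
      using annihilates_F1[OF assms] by (auto simp: coeff_at_inf_def)
  next
    case 2
    then show ?thesis unfolding poly_jump_comb
      using annihilates_B2[OF assms] by (simp add: coeff_at_0_def)
  next
    case 3
    then show ?thesis unfolding poly_jump_comb
      using annihilates_F1[OF assms] annihilates_B2[OF assms] by auto
  qed
  then show "poly (jump_comb J c x) (of_int h) = 0" by simp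
qed

lemma coeff_at_0_comb_eq_jump_comb:
  assumes "annihilates J c x" "v \<notin> F1"
  shows "(\<Sum>j\<in>J. c j * coeff_at_0 a N (x + j) (int v)) = (- 1) ^ v * poly (jump_comb J c x) (real v)"
proof -
  have "(\<Sum>j\<in>J. c j * coeff_at_inf a N (x + j) (int v)) = 0"
    using assms(2)
  proof (cases rule: not_in_F1_cases)
    case 1
    then show ?thesis by (simp add: coeff_at_inf_def)
  next
    case 2
    then show ?thesis using annihilates_B2[OF assms(1)] by simp
  qed
  then show ?thesis using poly_jump_comb[of "int v" J c x] by simp
qed

lemma degree_jump_comb:
  assumes "J \<subseteq> {..m}"
  shows "degree (jump_comb J c x) \<le> x + m - N - 1"
  unfolding jump_comb_def
proof (cases "finite J")
  case True
  show "degree (\<Sum>j\<in>J. Polynomial.smult (c j) (jump_poly a N (x + j))) \<le> x + m - N - 1"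
  proof (rule degree_sum_le[OF True])
    fix j assume "j \<in> J"
    then have "x + j - N - 1 \<le> x + m - N - 1" using assms by (intro diff_le_mono) auto
    then show "degree (Polynomial.smult (c j) (jump_poly a N (x + j))) \<le> x + m - N - 1"
      by (intro order_trans[OF degree_smult_le] order_trans[OF degree_jump_poly])
  qed
qed simp

text \<open>R_{x+j} vanishes at -a to order x + j, which exceeds the degree of \<open>s\<close> for
  j > 0; only column 0 survives.\<close>

lemma sum_poly_coeff_at_0_comb:
  assumes "degree s \<le> x"
  shows "(\<lambda>v. (- a) ^ v * poly s (real v) * (\<Sum>j\<le>m. c j * coeff_at_0 a N (x + j) (int v)))
    sums (c 0 * (coeff s x * (- 1) ^ x * fact x * (1 - a) powr (real N - real x)))"
proof -
  have "(\<lambda>v. \<Sum>j\<le>m. c j * ((- a) ^ v * poly s (real v) * coeff_at_0 a N (x + j) (int v))) sums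
      (\<Sum>j\<le>m. c j * (coeff s (x + j) * (- 1) ^ (x + j) * fact (x + j) * (1 - a) powr (real N - real (x + j))))"
    using assms a by (intro sums_sum sums_mult sum_poly_coeff_at_0) auto
  also have "(\<Sum>j\<le>m. c j * (coeff s (x + j) * (- 1) ^ (x + j) * fact (x + j) * (1 - a) powr (real N - real (x + j))))
      = (\<Sum>j\<le>m. if j = 0 then c 0 * (coeff s x * (- 1) ^ x * fact x * (1 - a) powr (real N - real x)) else 0)"
    using assms by (intro sum.cong) (auto simp: coeff_eq_0)
  finally show ?thesis by (simp add: sum_distrib_left mult_ac)
qed

lemma Om_eq: "Om x = ldet k (row_entry x)"
  by (simp add: Omega_def row_entry_def k_def)

text \<open>A kernel vector of the matrix of \<open>Omega 0\<close> gives a jump polynomial of too small a degree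
  to vanish on \<open>H\<close>; hence a combination of the expansions at \<open>0\<close> vanishes identically, which
  is impossible because they vanish to different orders at \<open>- a\<close>.\<close>

lemma Om_0_nonzero: "Om 0 \<noteq> 0"
proof
  assume "Om 0 = 0"
  then obtain c where c: "\<exists>j<k. c j \<noteq> 0" and ker: "\<And>i. i < k \<Longrightarrow> (\<Sum>j<k. c j * row_entry 0 i j) = 0"
    unfolding Om_eq by (rule ldet_eq_0_imp_kernel) blast
  have ann: "annihilates {..<k} c 0" using ker by (simp add: annihilates_def)
  have g0: "jump_comb {..<k} c 0 = 0"
  \<comment> \<open>If \<open>H\<close> is empty, the degree bound yields nothing under truncated
    subtraction; but then k = N + 1, and no column has a jump.\<close>
  proof (cases "card H = 0")
    case True
    then have "j \<le> N" if "j < k" for j using card_H that by linarith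
    then show ?thesis by (simp add: jump_comb_def jump_poly_eq_0)
  next
    case False
    have "{..<k} \<subseteq> {..k - 1}" by auto
    from degree_jump_comb[OF this, of c 0]
    have "degree (jump_comb {..<k} c 0) < degree Hpoly"
      using False card_H unfolding degree_Hpoly by linarith
    then show ?thesis
      using Hpoly_dvd_jump_comb[OF ann] dvd_imp_degree_le[of Hpoly "jump_comb {..<k} c 0"] by linarith
  qed
  have comb0: "(\<Sum>j<k. c j * coeff_at_0 a N j (int v)) = 0" for v
    using annihilates_F1[OF ann, of v] coeff_at_0_comb_eq_jump_comb[OF ann, of v] g0
    by (cases "v \<in> F1") auto
  \<comment> \<open>The lowest order of vanishing at -a in the combination; testing with the
    monomial of degree \<open>j0\<close> isolates its coefficient.\<close>
  define j0 where "j0 = (LEAST j. j < k \<and> c j \<noteq> 0)"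
  have j0: "j0 < k" "c j0 \<noteq> 0" using LeastI_ex[OF c[unfolded Bex_def]] unfolding j0_def by auto
  have least: "c j = 0" if "j < j0" for j
    using not_less_Least[of j "\<lambda>j. j < k \<and> c j \<noteq> 0"] that j0 by (auto simp: j0_def)
  have split: "(\<Sum>j<k. c j * coeff_at_0 a N j (int v))
      = (\<Sum>j\<le>k - 1 - j0. c (j0 + j) * coeff_at_0 a N (j0 + j) (int v))" for v
  proof -
    have "(\<Sum>j<k. c j * coeff_at_0 a N j (int v)) = (\<Sum>j=j0..<k. c j * coeff_at_0 a N j (int v))"
      by (rule sum.mono_neutral_right) (auto simp: least)
    also have "\<dots> = (\<Sum>j\<le>k - 1 - j0. c (j0 + j) * coeff_at_0 a N (j0 + j) (int v))"
      by (rule sum.reindex_bij_witness[of _ "\<lambda>j. j0 + j" "\<lambda>j. j - j0"]) (use j0 in auto)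
    finally show ?thesis .
  qed
  have "(\<lambda>v. (- a) ^ v * poly (Polynomial.monom 1 j0) (real v) *
      (\<Sum>j\<le>k - 1 - j0. c (j0 + j) * coeff_at_0 a N (j0 + j) (int v)))
    sums (c (j0 + 0) * (coeff (Polynomial.monom 1 j0) j0 * (- 1) ^ j0 * fact j0 * (1 - a) powr (real N - real j0)))"
    by (rule sum_poly_coeff_at_0_comb) (simp add: degree_monom_le)
  then have "(\<lambda>v. 0) sums (c j0 * ((- 1) ^ j0 * fact j0 * (1 - a) powr (real N - real j0)))"
    unfolding split[symmetric] comb0 by simp
  from sums_unique2[OF this sums_zero]
  have "c j0 * ((- 1) ^ j0 * fact j0 * (1 - a) powr (real N - real j0)) = 0" .
  then show False using j0 a by simp
qed

section \<open>The dual polynomials and their norms\<close>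

definition "cof x = first_row_cofactor k (row_entry x)"
definition "G x v = (\<Sum>j\<le>k. cof x j * coeff_at_0 a N (x + j) (int v))"
definition "g x = jump_comb {..k} (cof x) x"
definition "q x = g x div Hpoly"
text \<open>Zero mass on F1 lets all sums run over the naturals, matching \<open>G x v\<close>,
  which vanishes there.\<close>

definition "\<mu> v = (if v \<in> F1 then 0 else a ^ v * poly Hpoly (real v))"
definition "\<kappa> x = cof x 0 * (coeff (q x) x * (- 1) ^ x * fact x * (1 - a) powr (real N - real x))"

lemma annihilates_cof: "annihilates {..k} (cof x) x"
  unfolding annihilates_def cof_def using first_row_cofactor_orthogonal by blast

lemma cof_0: "cof x 0 = (1 / a) ^ card F2 * Om (Suc x)"
proof -
  have "(\<Prod>i<k. if i < card F1 then 1 else 1 / a) = (\<Prod>i\<in>{card F1..<k}. 1 / a)"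
    by (rule prod.mono_neutral_cong_right) (auto simp: k_def)
  then have "(\<Prod>i<k. if i < card F1 then 1 else 1 / a) = (1 / a) ^ card F2" by (simp add: k_def)
  then show ?thesis
    unfolding cof_def first_row_cofactor_0 row_entry_Suc ldet_scale_rows Om_eq by simp
qed

lemma cof_k: "cof x k = (- 1) ^ k * Om x"
  unfolding cof_def first_row_cofactor_last Om_eq ..

lemma g_eq: "g x = Hpoly * q x"
  using Hpoly_dvd_jump_comb[OF annihilates_cof, of x] by (simp add: q_def g_def)

lemma degree_q: "degree (q x) \<le> x"
proof (cases "q x = 0")
  case False
  have "degree (g x) \<le> x + k - N - 1" unfolding g_def by (rule degree_jump_comb) simp
  moreover have "degree (g x) = card H + degree (q x)"
    unfolding g_eq degree_Hpoly[symmetric] using False lead_coeff_Hpoly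
    by (intro degree_mult_eq) auto
  ultimately show ?thesis using card_H by linarith
qed simp

text \<open>Among the columns 0, ..., k only the last has a jump of the top degree, and its cofactor
  is Omega(x) up to sign.\<close>

lemma coeff_q: "coeff (q x) x = (- 1) ^ k * Om x * (1 - 1 / a) ^ (x + k) / fact (x + k - N - 1)"
proof -
  have "coeff (q x) x = coeff (g x) (card H + x)"
    unfolding g_eq by (simp add: coeff_mult_at_degree_bounds degree_Hpoly lead_coeff_Hpoly degree_q)
  also have "card H + x = x + k - N - 1" using card_H by linarith
  also have "coeff (g x) (x + k - N - 1) = (\<Sum>j\<le>k. cof x j * coeff (jump_poly a N (x + j)) (x + k - N - 1))"
    by (simp add: g_def jump_comb_def coeff_sum)
  also have "\<dots> = (\<Sum>j\<le>k. if j = k then cof x k * coeff (jump_poly a N (x + k)) (x + k - N - 1) else 0)"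
  proof (rule sum.cong[OF refl])
    fix j assume j: "j \<in> {..k}"
    have "coeff (jump_poly a N (x + j)) (x + k - N - 1) = 0" if "j \<noteq> k"
    proof (cases "x + j \<le> N")
      case True
      then show ?thesis by (simp add: jump_poly_eq_0)
    next
      case False
      then have "x + j - N - 1 < x + k - N - 1" using j that by auto
      then show ?thesis using degree_jump_poly[of a N "x + j"] by (intro coeff_eq_0) linarith
    qed
    then show "cof x j * coeff (jump_poly a N (x + j)) (x + k - N - 1)
        = (if j = k then cof x k * coeff (jump_poly a N (x + k)) (x + k - N - 1) else 0)" by simp
  qed
  also have "\<dots> = cof x k * ((1 - 1 / a) ^ (x + k) / fact (x + k - N - 1))"
    using card_H coeff_jump_poly[of N "x + k" a] by simp
  finally show ?thesis by (simp add: cof_k)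
qed

lemma G_eq_0: "v \<in> F1 \<Longrightarrow> G x v = 0"
  unfolding G_def by (rule annihilates_F1[OF annihilates_cof])

lemma G_eq: "v \<notin> F1 \<Longrightarrow> G x v = (- 1) ^ v * poly Hpoly (real v) * poly (q x) (real v)"
  using coeff_at_0_comb_eq_jump_comb[OF annihilates_cof, of v x]
  by (simp add: G_def g_def[symmetric] g_eq)

text \<open>The sign (-1)^v of the jump turns a^v into (-a)^v, so sums against \<open>\<mu>\<close>
  become evaluations at t = -a.\<close>

lemma \<mu>_q: "\<mu> v * poly (q x) (real v) = (- a) ^ v * G x v"
proof (cases "v \<in> F1")
  case False
  have "(- a) ^ v * (- 1) ^ v = a ^ v" by (simp flip: power_mult_distrib)
  then show ?thesis using False by (simp add: \<mu>_def G_eq mult.assoc[symmetric])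
qed (simp add: \<mu>_def G_eq_0)

lemma \<mu>_pos: "v \<notin> F1 \<Longrightarrow> 0 < \<mu> v"
  using a by (simp add: \<mu>_def poly_Hpoly_pos)

lemma \<mu>_nonneg: "0 \<le> \<mu> v"
  using \<mu>_pos[of v] by (cases "v \<in> F1") (auto simp: \<mu>_def)

lemma \<mu>_q_poly_sums:
  assumes "degree s \<le> x"
  shows "(\<lambda>v. \<mu> v * poly (q x) (real v) * poly s (real v)) sums
    (cof x 0 * (coeff s x * (- 1) ^ x * fact x * (1 - a) powr (real N - real x)))"
  using sum_poly_coeff_at_0_comb[OF assms, of "cof x" k]
  unfolding \<mu>_q by (simp add: G_def[symmetric] mult_ac)

lemma q_orthogonal:
  "(\<lambda>v. \<mu> v * poly (q x) (real v) * poly (q y) (real v)) sums (if x = y then \<kappa> x else 0)"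
proof -
  have less: "(\<lambda>v. \<mu> v * poly (q x) (real v) * poly (q y) (real v)) sums 0" if "y < x" for x y
  proof -
    have "degree (q y) < x" using degree_q[of y] that by linarith
    then show ?thesis using \<mu>_q_poly_sums[of "q y" x] by (simp add: coeff_eq_0)
  qed
  consider "x = y" | "y < x" | "x < y" by linarith
  then show ?thesis
  proof cases
    case 1
    then show ?thesis using \<mu>_q_poly_sums[OF degree_q, of x] by (simp add: \<kappa>_def)
  next
    case 2
    then show ?thesis using less[of y x] by simp
  next
    case 3
    then show ?thesis using less[of x y] by (simp add: mult_ac)
  qed
qed

text \<open>The signs from the leading coefficient and from the moment combine with the negative
  number 1 - 1/a into powers of (1 - a)/a, so the bracket is positive.\<close>

lemma \<kappa>_eq:
  "\<kappa> x = Om x * Om (Suc x) * (fact x / fact (x + k - N - 1) * (1 / a) ^ card F2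
     * ((1 - a) / a) ^ (x + k) * (1 - a) powr (real N - real x))"
proof -
  have "(1 - a) / a = (- 1) * (1 - 1 / a)" using a by (simp add: field_simps)
  then have "((1 - a) / a) ^ (x + k) = (- 1) ^ x * (- 1) ^ k * (1 - 1 / a) ^ (x + k)"
    by (simp only: power_mult_distrib power_add[of "-1"])
  then show ?thesis by (simp add: \<kappa>_def cof_0 coeff_q)
qed

lemma infinite_complement_F1: "infinite (- F1)"
  using fin(1) by (simp add: finite_compl)

text \<open>\<open>\<kappa> x\<close> is the squared norm of \<open>q x\<close>, which is then a
  nonzero polynomial with finitely many roots, while \<open>\<mu>\<close> charges infinitely many
  points.\<close>

lemma \<kappa>_pos:
  assumes "Om x \<noteq> 0"
  shows "0 < \<kappa> x"
proof -
  have "coeff (q x) x \<noteq> 0" using assms a by (simp add: coeff_q)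
  then have "q x \<noteq> 0" by auto
  then have "finite {r. poly (q x) r = 0}" by (rule poly_roots_finite)
  then have "finite (real -` {r. poly (q x) r = 0})" by (intro finite_vimageI) (auto simp: inj_on_def)
  then obtain v where v: "v \<notin> F1" "poly (q x) (real v) \<noteq> 0"
    using infinite_complement_F1 finite_subset[of "- F1" "real -` {r. poly (q x) r = 0}"] by auto
  have s: "(\<lambda>v. \<mu> v * poly (q x) (real v) * poly (q x) (real v)) sums \<kappa> x"
    using q_orthogonal[of x x] by simp
  have "0 < \<mu> v * poly (q x) (real v) * poly (q x) (real v)"
    using \<mu>_pos[OF v(1)] v(2) by (simp add: mult.assoc zero_less_mult_iff) (metis linorder_neqE_linordered_idom)
  also have "\<dots> = sum (\<lambda>v. \<mu> v * poly (q x) (real v) * poly (q x) (real v)) {v}" by simp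
  also have "\<dots> \<le> suminf (\<lambda>v. \<mu> v * poly (q x) (real v) * poly (q x) (real v))"
    using s \<mu>_nonneg by (intro sum_le_suminf) (auto simp: sums_iff mult.assoc)
  finally show ?thesis using s by (simp add: sums_iff)
qed

text \<open>\<open>\<kappa> x\<close> is positive and contains the factor Omega(x+1).\<close>

lemma Om_nonzero: "Om x \<noteq> 0"
proof (induction x)
  case 0
  show ?case using Om_0_nonzero by simp
next
  case (Suc x)
  then show ?case using \<kappa>_pos[of x] \<kappa>_eq[of x] by auto
qed

lemma coeff_q_nonzero: "coeff (q x) x \<noteq> 0"
  using Om_nonzero a by (simp add: coeff_q)

lemma q_dual_orthogonal:
  assumes "v \<notin> F1" "v' \<notin> F1"
  shows "(\<lambda>x. poly (q x) (real v) * poly (q x) (real v') / \<kappa> x) sums (if v = v' then 1 / \<mu> v else 0)"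
proof (rule dual_orthogonality[OF \<mu>_nonneg degree_q coeff_q_nonzero q_orthogonal])
  show "\<exists>p. l2_less \<mu> (\<lambda>v. (if v = v0 then 1 else 0) - poly p (real v)) \<epsilon>" if "0 < \<epsilon>" for v0 \<epsilon>
  proof (rule delta_approximable_by_polys_l2[OF a \<mu>_nonneg _ that])
    show "\<mu> v \<le> \<bar>poly Hpoly (real v)\<bar> * a ^ v" for v
      using a by (auto simp: \<mu>_def mult.commute mult_le_cancel_left abs_ge_self)
  qed (unfold l2_less_def, blast)
qed (use \<kappa>_pos Om_nonzero \<mu>_pos assms in auto)

section \<open>Return to the exceptional polynomials and their weight\<close>

definition "\<Lambda> = (1 / a) ^ (card F2 + k) * (1 - a) ^ (k + N)"

lemma \<Lambda>_pos: "0 < \<Lambda>"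
  using a by (simp add: \<Lambda>_def)

text \<open>All x-dependent powers of a and 1 - a cancel, so the weight is a constant multiple of
  the reciprocal row norm; this gives its positivity.\<close>

lemma weightF_eq: "weightF a (- int N) F1 F2 x = \<Lambda> / \<kappa> x"
proof -
  \<comment> \<open>The Gamma argument is the positive integer x + card H + 1, so Gamma is a
    factorial.\<close>
  have "real x + of_int (- int N) + real (card F1 + card F2) = 1 + real (x + k - N - 1)"
    using card_H by (simp add: k_def)
  then have w: "weightF a (- int N) F1 F2 x = a ^ x * fact (x + k - N - 1) / (fact x * Om x * Om (Suc x))"
    unfolding weightF_def by (simp add: Gamma_fact add.commute)
  have "(1 - a) ^ (x + k) * (1 - a) powr (real N - real x) = (1 - a) ^ (k + N)"
    using a by (simp add: powr_realpow[symmetric] powr_add[symmetric])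
  then have "a ^ x * ((1 / a) ^ card F2 * ((1 - a) / a) ^ (x + k) * (1 - a) powr (real N - real x)) = \<Lambda>"
    using a by (simp add: \<Lambda>_def power_divide power_add)
  then have "\<Lambda> / \<kappa> x = a ^ x * ((1 / a) ^ card F2 * ((1 - a) / a) ^ (x + k) * (1 - a) powr (real N - real x)) / \<kappa> x"
    by simp
  also have "\<dots> = weightF a (- int N) F1 F2 x"
    unfolding w \<kappa>_eq using Om_nonzero a by (simp add: field_simps)
  finally show ?thesis ..
qed

lemma exc_meixner_eq:
  assumes "int n = uF F1 F2 + int v"
  shows "exc_meixner a (- real N) F1 F2 n (real x) = (a / (1 - a)) ^ v * G x v"
proof -
  have nv: "nat (int n - uF F1 F2) = v" using assms by simp
  have "exc_meixner a (- real N) F1 F2 n (real x)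
      = ldet (Suc k) (\<lambda>i j. if i = 0 then meixner a (- real N) v (real (x + j)) else row_entry x (i - 1) j)"
    unfolding exc_meixner_def nv k_def row_entry_def of_nat_add by simp
  also have "\<dots> = (\<Sum>j\<le>k. cof x j * meixner a (- real N) v (real (x + j)))"
    unfolding cof_def by (rule ldet_first_row_expansion)
  also have "\<dots> = (a / (1 - a)) ^ v * G x v"
    unfolding meixner_eq_coeff_at_0 G_def by (simp add: sum_distrib_left mult_ac)
  finally show ?thesis .
qed

definition "\<gamma> v = (a / (1 - a)) ^ v * (- 1) ^ v * poly Hpoly (real v)"

lemma \<gamma>_nonzero: "v \<notin> F1 \<Longrightarrow> \<gamma> v \<noteq> 0"
  using poly_Hpoly_pos[of v] a by (simp add: \<gamma>_def)

text \<open>\<open>\<gamma> v\<close> squared carries the product over \<open>H\<close> twice and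
  \<open>\<mu> v\<close> once, leaving it once. The exponents agree since k1 - 2k = -(k2 +
  k).\<close>

lemma \<gamma>_square:
  assumes "v \<notin> F1" "int n = uF F1 F2 + int v"
  shows "\<Lambda> * (\<gamma> v)\<^sup>2 / \<mu> v =
    a powi (int n - uF F1 F2 + int (card F1) - 2 * int k)
      / (1 - a) powi (- int N + 2 * int n - 2 * uF F1 F2 - int k)
      * (\<Prod>h\<in>H. of_int (int n - uF F1 F2 - h))"
proof -
  have n: "int n - uF F1 F2 = int v" using assms(2) by simp
  have e1: "int n - uF F1 F2 + int (card F1) - 2 * int k = int v - int (card F2 + k)"
    using assms(2) by (simp add: k_def)
  have e2: "- int N + 2 * int n - 2 * uF F1 F2 - int k = int (2 * v) - int (k + N)"
    using assms(2) by simp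
  have H: "(\<Prod>h\<in>H. of_int (int n - uF F1 F2 - h)) = poly Hpoly (real v)"
    using poly_Hpoly[of "int v"] by (simp add: n)
  have "\<Lambda> * (\<gamma> v)\<^sup>2 / \<mu> v = (1 / a) ^ (card F2 + k) * (1 - a) ^ (k + N) * (a ^ (2 * v) / (1 - a) ^ (2 * v))
      * (poly Hpoly (real v))\<^sup>2 / (a ^ v * poly Hpoly (real v))"
    using assms(1) by (simp add: \<Lambda>_def \<gamma>_def \<mu>_def power_mult_distrib power_divide power_mult[symmetric]
        mult.commute)
  also have "\<dots> = a ^ v / a ^ (card F2 + k) / ((1 - a) ^ (2 * v) / (1 - a) ^ (k + N)) * poly Hpoly (real v)"
    using poly_Hpoly_pos[OF assms(1)] a unfolding mult_2 power_add[of a v v]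
    by (simp add: power_divide power2_eq_square mult_ac)
  also have "\<dots> = a powi (int v - int (card F2 + k)) / (1 - a) powi (int (2 * v) - int (k + N)) * poly Hpoly (real v)"
    using a by (subst (1 2) power_int_diff) (simp_all only: power_int_of_nat, auto)
  finally show ?thesis unfolding e1 e2 H .
qed

abbreviation "w \<equiv> weightF a (- int N) F1 F2"
abbreviation "P n x \<equiv> exc_meixner a (- real N) F1 F2 n (real x)"

lemma w_pos: "0 < w x"
  using \<Lambda>_pos \<kappa>_pos[OF Om_nonzero] by (simp add: weightF_eq)

lemma P_eq:
  assumes "v \<notin> F1" "int n = uF F1 F2 + int v"
  shows "P n x = \<gamma> v * poly (q x) (real v)"
  unfolding exc_meixner_eq[OF assms(2)] G_eq[OF assms(1)] \<gamma>_def by simp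

lemma sigmaF_D:
  assumes "n \<in> sigmaF F1 F2"
  obtains v where "v \<notin> F1" "int n = uF F1 F2 + int v"
proof
  have "uF F1 F2 \<le> int n" using assms by (simp add: sigmaF_def)
  then show n: "int n = uF F1 F2 + int (nat (int n - uF F1 F2))" by simp
  with assms show "nat (int n - uF F1 F2) \<notin> F1" by (auto simp: sigmaF_def)
qed

lemma P_orthogonal:
  assumes "n \<in> sigmaF F1 F2" "m \<in> sigmaF F1 F2"
  shows "(\<lambda>x. w x * P n x * P m x) sums
    (if n = m then \<Lambda> * (\<gamma> (nat (int n - uF F1 F2)))\<^sup>2 / \<mu> (nat (int n - uF F1 F2)) else 0)"
proof -
  obtain v where v: "v \<notin> F1" "int n = uF F1 F2 + int v" using assms(1) by (rule sigmaF_D)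
  obtain v' where v': "v' \<notin> F1" "int m = uF F1 F2 + int v'" using assms(2) by (rule sigmaF_D)
  have "(\<lambda>x. (\<Lambda> * \<gamma> v * \<gamma> v') * (poly (q x) (real v) * poly (q x) (real v') / \<kappa> x)) sums
      ((\<Lambda> * \<gamma> v * \<gamma> v') * (if v = v' then 1 / \<mu> v else 0))"
    by (intro sums_mult q_dual_orthogonal v v')
  also have "(\<lambda>x. (\<Lambda> * \<gamma> v * \<gamma> v') * (poly (q x) (real v) * poly (q x) (real v') / \<kappa> x))
      = (\<lambda>x. w x * P n x * P m x)"
    by (simp add: P_eq[OF v] P_eq[OF v'] weightF_eq mult_ac)
  finally show ?thesis using v(2) v'(2) by (auto simp: power2_eq_square mult.assoc)
qed

lemma P_orthogonal_abs_summable: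
  assumes "n \<in> sigmaF F1 F2" "m \<in> sigmaF F1 F2"
  shows "summable (\<lambda>x. \<bar>w x * P n x * P m x\<bar>)"
proof -
  have s: "summable (\<lambda>x. w x * P i x * P i x)" if "i \<in> sigmaF F1 F2" for i
    using P_orthogonal[OF that that] by (rule sums_summable)
  have le: "norm \<bar>w x * P n x * P m x\<bar> \<le> w x * P n x * P n x + w x * P m x * P m x" for x
  proof -
    have "(\<bar>P n x\<bar> - \<bar>P m x\<bar>)\<^sup>2 = P n x * P n x + P m x * P m x - 2 * (\<bar>P n x\<bar> * \<bar>P m x\<bar>)"
      by (simp add: power2_eq_square algebra_simps)
    moreover have "0 \<le> (\<bar>P n x\<bar> - \<bar>P m x\<bar>)\<^sup>2" "0 \<le> \<bar>P n x\<bar> * \<bar>P m x\<bar>" by simp_all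
    ultimately have "\<bar>P n x * P m x\<bar> \<le> P n x * P n x + P m x * P m x"
      unfolding abs_mult by linarith
    from mult_left_mono[OF this less_imp_le[OF w_pos[of x]]] show ?thesis
      using w_pos[of x] by (simp add: abs_mult mult.assoc distrib_left)
  qed
  show ?thesis
    by (rule summable_comparison_test'[OF summable_add[OF s[OF assms(1)] s[OF assms(2)]], of 0]) (rule le)
qed

text \<open>The Parseval identity for the columns at a point x is the norm identity of the row
  \<open>q x\<close>, divided by \<open>\<Lambda>\<close>.\<close>

lemma P_dense:
  assumes "0 \<le> uF F1 F2" and f: "summable (\<lambda>x. w x * (f x)\<^sup>2)"
  shows "in_l2_closed_span w P (sigmaF F1 F2) f"
proof -
  define K where "K n = \<Lambda> * (\<gamma> (nat (int n - uF F1 F2)))\<^sup>2 / \<mu> (nat (int n - uF F1 F2))" for n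
  have K: "0 < K n" if "n \<in> sigmaF F1 F2" for n
    using that
  proof (rule sigmaF_D)
    fix v assume "v \<notin> F1" "int n = uF F1 F2 + int v"
    then show ?thesis using \<Lambda>_pos \<gamma>_nonzero[of v] \<mu>_pos[of v] by (simp add: K_def)
  qed
  \<comment> \<open>As u is nonnegative, n = v + U reaches every v outside F1, and the remaining
    indices n < U lie outside \<open>sigmaF\<close>.\<close>
  define U where "U = nat (uF F1 F2)"
  have parseval: "(\<lambda>n. if n \<in> sigmaF F1 F2 then (P n x)\<^sup>2 / K n else 0) sums (1 / w x)" for x
  proof -
    have "(\<lambda>v. (\<mu> v * poly (q x) (real v) * poly (q x) (real v)) / \<Lambda>) sums (\<kappa> x / \<Lambda>)"
      using q_orthogonal[of x x] by (intro sums_divide) simp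
    also have "(\<lambda>v. (\<mu> v * poly (q x) (real v) * poly (q x) (real v)) / \<Lambda>)
        = (\<lambda>v. if v + U \<in> sigmaF F1 F2 then (P (v + U) x)\<^sup>2 / K (v + U) else 0)"
    proof
      fix v
      have n: "int (v + U) = uF F1 F2 + int v" using assms(1) by (simp add: U_def)
      then have mem: "v + U \<in> sigmaF F1 F2 \<longleftrightarrow> v \<notin> F1" by (auto simp: sigmaF_def)
      show "(\<mu> v * poly (q x) (real v) * poly (q x) (real v)) / \<Lambda>
          = (if v + U \<in> sigmaF F1 F2 then (P (v + U) x)\<^sup>2 / K (v + U) else 0)"
      proof (cases "v \<in> F1")
        case True
        then show ?thesis using mem by (simp add: \<mu>_def)
      next
        case False
        have "nat (int (v + U) - uF F1 F2) = v" using n by simp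
        then have "K (v + U) = \<Lambda> * (\<gamma> v)\<^sup>2 / \<mu> v" by (simp only: K_def)
        then show ?thesis using mem False \<gamma>_nonzero[of v] \<mu>_pos[of v] \<Lambda>_pos
          by (simp add: P_eq[OF False n] power2_eq_square)
      qed
    qed
    also have "\<kappa> x / \<Lambda> = 1 / w x" by (simp add: weightF_eq)
    finally show ?thesis
      by (subst (asm) sums_zero_iff_shift) (use assms(1) in \<open>auto simp: sigmaF_def U_def\<close>)
  qed
  show ?thesis
  proof (rule orthogonal_system_dense[OF w_pos _ K parseval f])
    show "(\<lambda>x. w x * P i x * P j x) sums (if i = j then K i else 0)"
      if "i \<in> sigmaF F1 F2" "j \<in> sigmaF F1 F2" for i j
      unfolding K_def by (rule P_orthogonal[OF that])
  qed
qed

end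

theorem mainTheorem10:
  fixes a :: real and ch :: int and F1 F2 :: "nat set"
  assumes a: "0 < a" "a < 1"
    and ch: "ch \<le> -1"
    and fin: "finite F1" "finite F2"
    and pos: "0 \<notin> F1" "0 \<notin> F2"
    and C: "{0 .. - ch} \<subseteq> int ` F1 \<union> (\<lambda>f. - ch - int f) ` F2"
    and adm: "admissible ch F1 F2"
  defines "w \<equiv> weightF a ch F1 F2"
    and "P \<equiv> (\<lambda>n x. exc_meixner a (of_int ch) F1 F2 n (real x))"
    and "k1 \<equiv> int (card F1)" and "k \<equiv> int (card F1 + card F2)"
    and "u \<equiv> uF F1 F2"
  shows "(\<forall>x. 0 \<le> w x)
    \<and> (\<forall>n\<in>sigmaF F1 F2. \<forall>m\<in>sigmaF F1 F2. n \<noteq> m \<longrightarrow>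
          summable (\<lambda>x. \<bar>w x * P n x * P m x\<bar>) \<and> (\<lambda>x. w x * P n x * P m x) sums 0)
    \<and> (\<forall>n\<in>sigmaF F1 F2.
          (\<lambda>x. w x * (P n x)\<^sup>2) sums
            (a powi (int n - u + k1 - 2 * k) / (1 - a) powi (ch + 2 * int n - 2 * u - k)
              * (\<Prod>h\<in>HF ch F1 F2. of_int (int n - u - h))))
    \<and> (\<forall>f :: nat \<Rightarrow> real. summable (\<lambda>x. w x * (f x)\<^sup>2) \<longrightarrow>
          (\<forall>\<epsilon>>0. \<exists>S c. finite S \<and> S \<subseteq> sigmaF F1 F2 \<and>
             summable (\<lambda>x. w x * (f x - (\<Sum>n\<in>S. c n * P n x))\<^sup>2) \<and>
             (\<Sum>x. w x * (f x - (\<Sum>n\<in>S. c n * P n x))\<^sup>2) < \<epsilon>))"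
proof -
  define N where "N = nat (- ch)"
  have chN: "ch = - int N" using ch by (simp add: N_def)
  interpret M: exceptional_meixner a N F1 F2
    using a fin C adm by unfold_locales (simp_all add: chN)
  have w: "w = weightF a (- int N) F1 F2" by (simp add: w_def chN)
  have P: "P = (\<lambda>n x. exc_meixner a (- real N) F1 F2 n (real x))" by (simp add: P_def chN)
  have H: "HF (- int N) F1 F2 = M.H" by (simp add: M.H_def)
  have k: "k = int M.k" by (simp add: k_def M.k_def)
  show ?thesis
  proof (intro conjI ballI allI impI)
    show "0 \<le> w x" for x using M.w_pos[of x] by (simp add: w)
  next
    fix n m assume nm: "n \<in> sigmaF F1 F2" "m \<in> sigmaF F1 F2" "n \<noteq> m"
    show "summable (\<lambda>x. \<bar>w x * P n x * P m x\<bar>)"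
      using M.P_orthogonal_abs_summable[OF nm(1,2)] by (simp add: w P)
    show "(\<lambda>x. w x * P n x * P m x) sums 0"
      using M.P_orthogonal[OF nm(1,2)] nm(3) by (simp add: w P)
  next
    fix n assume n: "n \<in> sigmaF F1 F2"
    then obtain v where v: "v \<notin> F1" "int n = uF F1 F2 + int v" by (rule M.sigmaF_D)
    have nv: "nat (int n - uF F1 F2) = v" using v(2) by simp
    have "(\<lambda>x. w x * (P n x)\<^sup>2) sums (M.\<Lambda> * (M.\<gamma> v)\<^sup>2 / M.\<mu> v)"
      using M.P_orthogonal[OF n n] unfolding nv by (simp add: w P power2_eq_square mult.assoc)
    then show "(\<lambda>x. w x * (P n x)\<^sup>2) sums
            (a powi (int n - u + k1 - 2 * k) / (1 - a) powi (ch + 2 * int n - 2 * u - k)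
              * (\<Prod>h\<in>HF ch F1 F2. of_int (int n - u - h)))"
      unfolding M.\<gamma>_square[OF v] H k u_def k1_def chN .
  next
    fix f :: "nat \<Rightarrow> real" and \<epsilon> :: real
    assume "summable (\<lambda>x. w x * (f x)\<^sup>2)" and e: "0 < \<epsilon>"
    then have "in_l2_closed_span w P (sigmaF F1 F2) f"
      unfolding w P by (intro M.P_dense uF_nonneg fin pos)
    then show "\<exists>S c. finite S \<and> S \<subseteq> sigmaF F1 F2 \<and>
             summable (\<lambda>x. w x * (f x - (\<Sum>n\<in>S. c n * P n x))\<^sup>2) \<and>
             (\<Sum>x. w x * (f x - (\<Sum>n\<in>S. c n * P n x))\<^sup>2) < \<epsilon>"
      using e unfolding in_l2_closed_span_def l2_less_def by blast
  qed
qed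

end
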